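(* Let $q\in\Bbbk^{\times}$ and let $G\ge 1$ be an integer. Pulling back representations along the surjective algebra map $\nu_G: B_q(G)\to \Bbbk_q[X,Y]$ induces a bijection $\operatorname{irrep} \Bbbk_q[X,Y]\simeq \operatorname{irrep} B_q(G)$. In particular, every finite-dimensional simple $B_q(G)$-module factors through $\nu_G$.
   Context: $\Bbbk$ is an algebraically closed field of characteristic $0$. Modules are left modules. For an algebra $A$, $\operatorname{irrep} A$ denotes the set of isomorphism classes of finite-dimensional simple $A$-modules. For $q\in\Bbbk^\times$ and an integer $G\ge 1$, $B_q(G)$ (the Laistrygonian Nichols algebra, denoted $\mathscr B(\mathfrak L_q(1,G))$) is the associative unital $\Bbbk$-algebra generated by $x_1,x_2,z_0,z_1,\dots,z_G$ with defining relations $$x_2x_1-x_1x_2+\tfrac12x_1^2=0,\quad x_1z_0=q\,z_0x_1,\quad z_nz_{n+1}=q^{-1}z_{n+1}z_n\ (0\le n\le G-1),$$ $$x_2z_n-q z_nx_2=z_{n+1}\ (0\le n\le G-1),\quad x_2z_G=q z_Gx_2 .$$ $\Bbbk_q[X,Y]$ is the algebra generated by $X,Y$ with the single defining relation $XY=qYX$. The surjective algebra map $\nu_G:B_q(G)\to\Bbbk_q[X,Y]$ is given by $\nu_G(x_1)=0$, $\nu_G(z_j)=0$ for $1\le j\le G$, $\nu_G(x_2)=X$, $\nu_G(z_0)=Y$. *)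

theory Defs
  imports
    "HOL-Computational_Algebra.Polynomial"
    "HOL-Library.Poly_Mapping"
    "HOL-Algebra.QuotRing"
    "HOL-Algebra.Module"
begin

section \<open>Algebras given by generators and relations\<close>

text \<open>
  A \<open>\<k>\<close>-algebra is a record of type \<^typ>\<open>('k, 'a) module\<close> (a ring together with a scalar
  multiplication); the base field is a type \<open>'k\<close>. The library locale for algebras is not
  used, as it requires commutative rings.

  Words form a monoid under concatenation, so that \<open>'g word \<Rightarrow>\<^sub>0 'k\<close> with the convolution
  product is the free associative unital algebra on the letters of type \<open>'g\<close>. A separate type
  is used because the libraries contain a pointwise addition on lists.
\<close>

datatype 'g word = Word (letters: "'g list")

instantiation word :: (type) monoid_add
begin

definition zero_word :: "'a word" where
  "0 = Word []"

definition plus_word :: "'a word \<Rightarrow> 'a word \<Rightarrow> 'a word" where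
  "u + v = Word (letters u @ letters v)"

instance
  by intro_classes (simp_all add: zero_word_def plus_word_def)

end

type_synonym ('g, 'k) ncpoly = "'g word \<Rightarrow>\<^sub>0 'k"

definition gen :: "'g \<Rightarrow> ('g, 'k::field) ncpoly" where
  "gen g = Poly_Mapping.single (Word [g]) 1"

definition const :: "'k \<Rightarrow> ('g, 'k::field) ncpoly" where
  "const c = Poly_Mapping.single 0 c"

definition free_alg :: "'g set \<Rightarrow> ('k::field, ('g, 'k) ncpoly) module" where
  "free_alg S =
     \<lparr>carrier = {p. \<forall>w \<in> Poly_Mapping.keys p. set (letters w) \<subseteq> S},
      mult = (*), one = 1, zero = 0, add = (+), smult = (\<lambda>c p. const c * p)\<rparr>"

definition quot_alg :: "('k, 'a) module \<Rightarrow> 'a set \<Rightarrow> ('k, 'a set) module" where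
  "quot_alg A I = ring.extend (A Quot I)
     (module.fields (\<lambda>c X. \<Union>x\<in>X. I +>\<^bsub>A\<^esub> (c \<odot>\<^bsub>A\<^esub> x)))"

definition presented_alg ::
    "'g set \<Rightarrow> ('g, 'k::field) ncpoly set \<Rightarrow> ('k, ('g, 'k) ncpoly set) module" where
  "presented_alg S R = quot_alg (free_alg S) (Idl\<^bsub>free_alg S\<^esub> R)"

definition subst :: "('g \<Rightarrow> ('h, 'k::field) ncpoly) \<Rightarrow> ('g, 'k) ncpoly \<Rightarrow> ('h, 'k) ncpoly" where
  "subst f p = (\<Sum>w \<in> Poly_Mapping.keys p.
     const (Poly_Mapping.lookup p w) * prod_list (map f (letters w)))"


section \<open>The two algebras and the map between them\<close>

datatype lgen = X1 | X2 | Z nat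

definition lgens :: "nat \<Rightarrow> lgen set" where
  "lgens G = {X1, X2} \<union> Z ` {0..G}"

definition lrels :: "'k::field \<Rightarrow> nat \<Rightarrow> (lgen, 'k) ncpoly set" where
  "lrels q G =
     (let x1 = gen X1; x2 = gen X2; z = (\<lambda>n. gen (Z n)) in
       {x2 * x1 - x1 * x2 + const (1 / 2) * x1 ^ 2,
        x1 * z 0 - const q * z 0 * x1,
        x2 * z G - const q * z G * x2}
     \<union> {z n * z (n + 1) - const (inverse q) * z (n + 1) * z n |n. n < G}
     \<union> {x2 * z n - const q * z n * x2 - z (n + 1) |n. n < G})"

definition laistrygonian :: "'k::field \<Rightarrow> nat \<Rightarrow> ('k, (lgen, 'k) ncpoly set) module" where
  "laistrygonian q G = presented_alg (lgens G) (lrels q G)"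

datatype pgen = X | Y

definition prels :: "'k::field \<Rightarrow> (pgen, 'k) ncpoly set" where
  "prels q = {gen X * gen Y - const q * gen Y * gen X}"

definition quantum_plane :: "'k::field \<Rightarrow> ('k, (pgen, 'k) ncpoly set) module" where
  "quantum_plane q = presented_alg UNIV (prels q)"

fun nu_gen :: "lgen \<Rightarrow> (pgen, 'k::field) ncpoly" where
  "nu_gen X1 = 0"
| "nu_gen X2 = gen X"
| "nu_gen (Z j) = (if j = 0 then gen Y else 0)"

text \<open>
  The map \<open>\<nu>\<^sub>G\<close>, as a map on cosets: all representatives \<open>p\<close> of a coset \<open>C\<close> contribute the
  same coset to the union. It depends on \<open>G\<close> only through its domain. That it is a surjective
  algebra map with the prescribed values on the generators is proved at the end.
\<close>

definition nu ::
    "'k::field \<Rightarrow> (lgen, 'k) ncpoly set \<Rightarrow> (pgen, 'k) ncpoly set" where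
  "nu q C = (\<Union>p\<in>C. (Idl\<^bsub>free_alg UNIV\<^esub> (prels q)) +>\<^bsub>free_alg UNIV\<^esub> subst nu_gen p)"


section \<open>Finite-dimensional simple modules\<close>

text \<open>
  The library locale \<^locale>\<open>module\<close> requires a commutative ring; this is the same notion
  over an arbitrary ring. The components \<^const>\<open>mult\<close> and \<^const>\<open>one\<close> of a module record
  are irrelevant, as in the library.
\<close>

locale left_module = R?: ring R + M?: abelian_group M
  for R (structure) and M (structure) +
  assumes smult_closed:
      "\<lbrakk>a \<in> carrier R; x \<in> carrier M\<rbrakk> \<Longrightarrow> a \<odot>\<^bsub>M\<^esub> x \<in> carrier M"
    and smult_l_distr:
      "\<lbrakk>a \<in> carrier R; b \<in> carrier R; x \<in> carrier M\<rbrakk> \<Longrightarrow>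
       (a \<oplus> b) \<odot>\<^bsub>M\<^esub> x = a \<odot>\<^bsub>M\<^esub> x \<oplus>\<^bsub>M\<^esub> b \<odot>\<^bsub>M\<^esub> x"
    and smult_r_distr:
      "\<lbrakk>a \<in> carrier R; x \<in> carrier M; y \<in> carrier M\<rbrakk> \<Longrightarrow>
       a \<odot>\<^bsub>M\<^esub> (x \<oplus>\<^bsub>M\<^esub> y) = a \<odot>\<^bsub>M\<^esub> x \<oplus>\<^bsub>M\<^esub> a \<odot>\<^bsub>M\<^esub> y"
    and smult_assoc:
      "\<lbrakk>a \<in> carrier R; b \<in> carrier R; x \<in> carrier M\<rbrakk> \<Longrightarrow>
       (a \<otimes> b) \<odot>\<^bsub>M\<^esub> x = a \<odot>\<^bsub>M\<^esub> (b \<odot>\<^bsub>M\<^esub> x)"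
    and smult_one:
      "x \<in> carrier M \<Longrightarrow> \<one> \<odot>\<^bsub>M\<^esub> x = x"

text \<open>The base field acts on a module over an algebra \<open>A\<close> through \<open>c \<mapsto> c \<cdot> 1\<^sub>A\<close>.\<close>

definition finite_dim :: "('k, 'a) module \<Rightarrow> ('a, 'v) module \<Rightarrow> bool" where
  "finite_dim A M \<longleftrightarrow>
     (\<exists>S. finite S \<and> S \<subseteq> carrier M \<and>
       (\<forall>v \<in> carrier M. \<exists>c. v = (\<Oplus>\<^bsub>M\<^esub>s\<in>S. (c s \<odot>\<^bsub>A\<^esub> \<one>\<^bsub>A\<^esub>) \<odot>\<^bsub>M\<^esub> s)))"

definition simple_module :: "('k, 'a) module \<Rightarrow> ('a, 'v) module \<Rightarrow> bool" where
  "simple_module A M \<longleftrightarrow>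
     left_module A M \<and> carrier M \<noteq> {\<zero>\<^bsub>M\<^esub>} \<and>
     (\<forall>N. submodule N A M \<longrightarrow> N = {\<zero>\<^bsub>M\<^esub>} \<or> N = carrier M)"

definition fd_simple :: "('k, 'a) module \<Rightarrow> ('a, 'v) module set" where
  "fd_simple A = {M. simple_module A M \<and> finite_dim A M}"

definition isomorphic ::
    "('k, 'a) module \<Rightarrow> ('a, 'v) module \<Rightarrow> ('a, 'w) module \<Rightarrow> bool" where
  "isomorphic A M N \<longleftrightarrow>
     (\<exists>h. bij_betw h (carrier M) (carrier N) \<and>
       (\<forall>x \<in> carrier M. \<forall>y \<in> carrier M. h (x \<oplus>\<^bsub>M\<^esub> y) = h x \<oplus>\<^bsub>N\<^esub> h y) \<and>
       (\<forall>a \<in> carrier A. \<forall>x \<in> carrier M. h (a \<odot>\<^bsub>M\<^esub> x) = a \<odot>\<^bsub>N\<^esub> h x))"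

text \<open>
  The set of isomorphism classes is formed over modules whose carrier is a subset of a type
  \<open>'v\<close>. A statement for arbitrary \<open>'v\<close> covers all finite-dimensional modules: each of them is
  isomorphic to one whose carrier is contained in \<open>'v = nat \<Rightarrow> 'k\<close>.
\<close>

definition iso_rel :: "('k, 'a) module \<Rightarrow> (('a, 'v) module \<times> ('a, 'v) module) set" where
  "iso_rel A = {(M, N). M \<in> fd_simple A \<and> N \<in> fd_simple A \<and> isomorphic A M N}"

definition irrep :: "('k, 'a) module \<Rightarrow> ('a, 'v) module set set" where
  "irrep A = fd_simple A // iso_rel A"

definition pullback :: "('a \<Rightarrow> 'b) \<Rightarrow> ('b, 'v) module \<Rightarrow> ('a, 'v) module" where
  "pullback f N =
     \<lparr>carrier = carrier N, mult = mult N, one = one N, zero = zero N, add = add N,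
      smult = (\<lambda>a v. f a \<odot>\<^bsub>N\<^esub> v)\<rparr>"

definition pullback_class ::
    "('k, 'a) module \<Rightarrow> ('a \<Rightarrow> 'b) \<Rightarrow> ('b, 'v) module \<Rightarrow> ('a, 'v) module set" where
  "pullback_class A f N = iso_rel A `` {pullback f N}"

definition factors_through ::
    "('k, 'a) module \<Rightarrow> ('k, 'b) module \<Rightarrow> ('a \<Rightarrow> 'b) \<Rightarrow> ('a, 'v) module \<Rightarrow> bool" where
  "factors_through A B f M \<longleftrightarrow>
     (\<exists>N :: ('b, 'v) module. left_module B N \<and> carrier N = carrier M \<and> zero N = zero M \<and> add N = add M \<and>
       (\<forall>a \<in> carrier A. \<forall>v \<in> carrier M. a \<odot>\<^bsub>M\<^esub> v = f a \<odot>\<^bsub>N\<^esub> v))"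


section \<open>Well-definedness of the algebras and of the map between them\<close>

lemma carrier_free_alg:
  "p \<in> carrier (free_alg S) \<longleftrightarrow> (\<forall>w. w \<in> Poly_Mapping.keys p \<longrightarrow> set (letters w) \<subseteq> S)"
  by (auto simp: free_alg_def)

lemma free_alg_ops:
  "mult (free_alg S) = (*)" "one (free_alg S) = 1" "zero (free_alg S) = 0"
  "add (free_alg S) = (+)" "smult (free_alg S) = (\<lambda>c p. const c * p)"
  by (simp_all add: free_alg_def)

lemma free_alg_closed:
  fixes p r :: "('g, 'k::field) ncpoly"
  shows "0 \<in> carrier (free_alg S :: ('k, ('g, 'k) ncpoly) module)"
    and "1 \<in> carrier (free_alg S :: ('k, ('g, 'k) ncpoly) module)"
    and "const c \<in> carrier (free_alg S :: ('k, ('g, 'k) ncpoly) module)"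
    and "\<lbrakk>p \<in> carrier (free_alg S); r \<in> carrier (free_alg S)\<rbrakk> \<Longrightarrow> p + r \<in> carrier (free_alg S)"
    and "\<lbrakk>p \<in> carrier (free_alg S); r \<in> carrier (free_alg S)\<rbrakk> \<Longrightarrow> p - r \<in> carrier (free_alg S)"
    and "p \<in> carrier (free_alg S) \<Longrightarrow> - p \<in> carrier (free_alg S)"
    and "\<lbrakk>p \<in> carrier (free_alg S); r \<in> carrier (free_alg S)\<rbrakk> \<Longrightarrow> p * r \<in> carrier (free_alg S)"
    and "g \<in> S \<Longrightarrow> gen g \<in> carrier (free_alg S :: ('k, ('g, 'k) ncpoly) module)"
proof -
  show "- p \<in> carrier (free_alg S)" if "p \<in> carrier (free_alg S)" for p :: "('g, 'k) ncpoly"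
    using that by (simp add: carrier_free_alg)
  moreover show "p + r \<in> carrier (free_alg S)"
    if "p \<in> carrier (free_alg S)" "r \<in> carrier (free_alg S)" for p r :: "('g, 'k) ncpoly"
    using that keys_add[of p r] unfolding carrier_free_alg by blast
  ultimately show "p - r \<in> carrier (free_alg S)"
    if "p \<in> carrier (free_alg S)" "r \<in> carrier (free_alg S)"
    using that by (metis diff_conv_add_uminus)
  show "p * r \<in> carrier (free_alg S)"
    if *: "p \<in> carrier (free_alg S)" "r \<in> carrier (free_alg S)"
    unfolding carrier_free_alg
  proof (intro allI impI)
    fix w assume "w \<in> Poly_Mapping.keys (p * r)"
    then obtain u v where "w = u + v" "u \<in> Poly_Mapping.keys p" "v \<in> Poly_Mapping.keys r"
      using keys_mult[of p r] by blast
    with * show "set (letters w) \<subseteq> S"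
      by (simp add: carrier_free_alg plus_word_def)
  qed
qed (auto simp: carrier_free_alg zero_word_def const_def gen_def)

lemma ring_free_alg: "ring (free_alg S :: ('k::field, ('g, 'k) ncpoly) module)"
proof (rule ringI)
  show "abelian_group (free_alg S :: ('k, ('g, 'k) ncpoly) module)"
  proof (rule abelian_groupI)
    fix x :: "('g, 'k) ncpoly" assume "x \<in> carrier (free_alg S)"
    then show "\<exists>y\<in>carrier (free_alg S). y \<oplus>\<^bsub>free_alg S\<^esub> x = \<zero>\<^bsub>free_alg S\<^esub>"
      by (intro bexI[of _ "- x"]) (simp_all add: free_alg_ops free_alg_closed)
  qed (simp_all add: free_alg_ops free_alg_closed ac_simps)
  show "Group.monoid (free_alg S :: ('k, ('g, 'k) ncpoly) module)"
    by (rule monoidI) (simp_all add: free_alg_ops free_alg_closed mult.assoc)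
qed (simp_all add: free_alg_ops distrib_left distrib_right)

lemma quot_alg_simps:
  "carrier (quot_alg A I) = a_rcosets\<^bsub>A\<^esub> I"
  "mult (quot_alg A I) = rcoset_mult A I"
  "one (quot_alg A I) = I +>\<^bsub>A\<^esub> \<one>\<^bsub>A\<^esub>"
  "zero (quot_alg A I) = I"
  "add (quot_alg A I) = set_add A"
  "smult (quot_alg A I) = (\<lambda>c X. \<Union>x\<in>X. I +>\<^bsub>A\<^esub> (c \<odot>\<^bsub>A\<^esub> x))"
  by (simp_all add: quot_alg_def ring.extend_def module.fields_def FactRing_def)

lemma ring_quot_alg:
  assumes "ideal I A"
  shows "ring (quot_alg A I)"
proof -
  interpret ideal I A by fact
  interpret Q: ring "A Quot I" by (rule quotient_is_ring)
  have eq: "carrier (quot_alg A I) = carrier (A Quot I)" "mult (quot_alg A I) = mult (A Quot I)"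
    "one (quot_alg A I) = one (A Quot I)" "zero (quot_alg A I) = zero (A Quot I)"
    "add (quot_alg A I) = add (A Quot I)"
    by (simp_all add: quot_alg_simps FactRing_def)
  show ?thesis
  proof (rule ringI)
    show "abelian_group (quot_alg A I)"
      by (rule abelian_groupI; unfold eq)
        (simp_all add: Q.add.m_ac Q.add.l_inv_ex)
    show "Group.monoid (quot_alg A I)"
      by (rule monoidI; unfold eq) (simp_all add: Q.m_assoc)
  qed (simp_all add: eq Q.l_distr Q.r_distr)
qed

lemma subst_superset:
  assumes "finite K" "Poly_Mapping.keys p \<subseteq> K"
  shows "subst f p = (\<Sum>w \<in> K. const (Poly_Mapping.lookup p w) * prod_list (map f (letters w)))"
  unfolding subst_def
  by (rule sum.mono_neutral_left) (use assms in \<open>auto simp: const_def in_keys_iff\<close>)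

lemma const_add: "const (a + b) = const a + const b"
  by (simp add: const_def single_add)

lemma const_mult: "const (a * b) = const a * const b"
  by (simp add: const_def mult_single)

lemma ncpoly_induct [case_names zero single add]:
  fixes p :: "'a \<Rightarrow>\<^sub>0 'b::comm_monoid_add"
  assumes "P 0" and "\<And>k v. P (Poly_Mapping.single k v)" and "\<And>p r. P p \<Longrightarrow> P r \<Longrightarrow> P (p + r)"
  shows "P p"
proof (induction p rule: update_induct)
  case const then show ?case using assms(1) .
next
  case (update f a b)
  then have "Poly_Mapping.update a b f = Poly_Mapping.single a b + f"
    by (intro poly_mapping_eqI) (auto simp: lookup_update lookup_add lookup_single in_keys_iff when_def)
  then show ?case using assms(2,3) update by metis
qed

lemma const_comm: "const c * p = p * (const c :: ('g, 'k::field) ncpoly)"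
proof (induction p rule: ncpoly_induct)
  case (single k v) then show ?case by (simp add: const_def mult_single mult.commute)
qed (simp_all add: algebra_simps)

lemma subst_add: "subst f (p + r) = subst f p + subst f r"
proof -
  let ?K = "Poly_Mapping.keys p \<union> Poly_Mapping.keys r"
  have "Poly_Mapping.keys (p + r) \<subseteq> ?K" by (rule keys_add)
  then show ?thesis
    by (simp add: subst_superset[of ?K] lookup_add const_add algebra_simps sum.distrib)
qed

lemma subst_single: "subst f (Poly_Mapping.single w c) = const c * prod_list (map f (letters w))"
  by (simp add: subst_def const_def)

lemma subst_mult: "subst f (p * r) = subst f p * subst f r"
proof (induction p rule: ncpoly_induct)
  case p: (single k v)
  show ?case
  proof (induction r rule: ncpoly_induct)
    case (single l u)
    have "const v * (const u * (a * b)) = const v * (a * (const u * b))"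
      for a b by (metis const_comm mult.assoc)
    then show ?case
      by (simp add: mult_single subst_single plus_word_def const_mult mult.assoc)
  qed (simp_all add: subst_def[of _ 0] subst_add distrib_left)
qed (simp_all add: subst_def[of _ 0] subst_add distrib_right)

lemma subst_0: "subst f 0 = 0"
  by (simp add: subst_def)

lemma subst_const: "subst f (const c) = const c"
  by (simp add: const_def[of c] subst_single zero_word_def)

lemma subst_1: "subst f 1 = 1"
  using subst_const[of f 1] by (simp add: const_def)

lemma subst_gen: "subst f (gen g) = f g"
  by (simp add: gen_def subst_single const_def)

lemma subst_diff: "subst f (p - r) = subst f p - subst f r"
  by (metis add_diff_cancel diff_add_cancel subst_add)

lemmas subst_simps = subst_0 subst_1 subst_const subst_gen subst_add subst_diff subst_mult

definition lideal :: "'k::field \<Rightarrow> nat \<Rightarrow> (lgen, 'k) ncpoly set" where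
  "lideal q G = Idl\<^bsub>free_alg (lgens G)\<^esub> (lrels q G)"

definition pideal :: "'k::field \<Rightarrow> (pgen, 'k) ncpoly set" where
  "pideal q = Idl\<^bsub>free_alg UNIV\<^esub> (prels q)"

lemma lrels_carrier: "lrels q G \<subseteq> carrier (free_alg (lgens G))"
  by (auto simp: lrels_def Let_def power2_eq_square lgens_def intro!: free_alg_closed)

lemma prels_carrier: "prels q \<subseteq> carrier (free_alg UNIV)"
  by (auto simp: carrier_free_alg)

lemma ideal_lideal: "ideal (lideal q G) (free_alg (lgens G))"
  unfolding lideal_def by (intro ring.genideal_ideal ring_free_alg lrels_carrier)

lemma ideal_pideal: "ideal (pideal q) (free_alg UNIV)"
  unfolding pideal_def by (intro ring.genideal_ideal ring_free_alg prels_carrier)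

lemma laistrygonian_eq: "laistrygonian q G = quot_alg (free_alg (lgens G)) (lideal q G)"
  by (simp add: laistrygonian_def presented_alg_def lideal_def)

lemma quantum_plane_eq: "quantum_plane q = quot_alg (free_alg UNIV) (pideal q)"
  by (simp add: quantum_plane_def presented_alg_def pideal_def)

lemma ring_laistrygonian: "ring (laistrygonian q G)"
  unfolding laistrygonian_eq by (intro ring_quot_alg ideal_lideal)

lemma ring_quantum_plane: "ring (quantum_plane q)"
  unfolding quantum_plane_eq by (intro ring_quot_alg ideal_pideal)

lemma subst_nu_lideal:
  assumes "G \<ge> 1" and "p \<in> lideal q G"
  shows "subst nu_gen p \<in> pideal q"
proof -
  interpret J: ideal "pideal q" "free_alg UNIV" by (rule ideal_pideal)
  have hom: "ring_hom_ring (free_alg (lgens G)) (free_alg UNIV) (subst (nu_gen :: _ \<Rightarrow> (_, 'a) ncpoly))"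
    by (intro ring_hom_ringI2 ring_free_alg ring_hom_memI)
       (auto simp: free_alg_ops subst_simps carrier_free_alg)
  let ?K = "{p \<in> carrier (free_alg (lgens G)). subst nu_gen p \<in> pideal q}"
  have "prels q \<subseteq> pideal q"
    unfolding pideal_def by (intro ring.genideal_self ring_free_alg prels_carrier)
  then have rel: "gen X * gen Y - const q * gen Y * gen X \<in> pideal q"
    by (simp add: prels_def)
  have zero: "0 \<in> pideal q"
    using additive_subgroup.zero_closed[OF ideal.axioms(1)[OF ideal_pideal]]
    by (simp add: free_alg_ops)
  have "lrels q G \<subseteq> ?K"
    using lrels_carrier[of q G] rel zero \<open>G \<ge> 1\<close>
    by (auto simp: lrels_def Let_def subst_simps power2_eq_square)
  moreover have "ideal ?K (free_alg (lgens G))"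
    by (rule ring_hom_ring.ideal_vimage[OF hom ideal_pideal])
  ultimately have "lideal q G \<subseteq> ?K"
    unfolding lideal_def by (intro ring.genideal_minimal ring_free_alg)
  then show ?thesis using assms by blast
qed

lemma quot_alg_smult:
  assumes "ideal I (free_alg S)" and "p \<in> carrier (free_alg S)"
  shows "c \<odot>\<^bsub>quot_alg (free_alg S) I\<^esub> (I +>\<^bsub>free_alg S\<^esub> p) = I +>\<^bsub>free_alg S\<^esub> (const c * p)"
proof -
  interpret ideal I "free_alg S" by fact
  have "I +>\<^bsub>free_alg S\<^esub> (const c * p') = I +>\<^bsub>free_alg S\<^esub> (const c * p)"
    if "p' \<in> I +>\<^bsub>free_alg S\<^esub> p" for p'
  proof -
    from that obtain i where i: "i \<in> I" "p' = i + p"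
      by (auto simp: a_r_coset_def' free_alg_ops)
    have "const c * i \<in> I"
      using I_l_closed[OF i(1) free_alg_closed(3)[of c]] by (simp add: free_alg_ops)
    then have "const c * p' \<in> I +>\<^bsub>free_alg S\<^esub> (const c * p)"
      by (auto simp: a_r_coset_def' free_alg_ops i distrib_left)
    then show ?thesis
      by (intro a_repr_independence[symmetric]) (use assms(2) in \<open>simp_all add: free_alg_closed a_subgroup\<close>)
  qed
  moreover have "p \<in> I +>\<^bsub>free_alg S\<^esub> p"
    using assms(2) by (rule a_rcos_self)
  ultimately show ?thesis
    unfolding quot_alg_simps free_alg_ops by (intro SUP_eq_const) blast+
qed

lemma nu_coset:
  assumes "G \<ge> 1" and p: "p \<in> carrier (free_alg (lgens G))"
  shows "nu q (lideal q G +>\<^bsub>free_alg (lgens G)\<^esub> p) = pideal q +>\<^bsub>free_alg UNIV\<^esub> subst nu_gen p"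
proof -
  interpret I: ideal "lideal q G" "free_alg (lgens G)" by (rule ideal_lideal)
  interpret J: ideal "pideal q" "free_alg UNIV" by (rule ideal_pideal)
  have "pideal q +>\<^bsub>free_alg UNIV\<^esub> subst nu_gen p' = pideal q +>\<^bsub>free_alg UNIV\<^esub> subst nu_gen p"
    if "p' \<in> lideal q G +>\<^bsub>free_alg (lgens G)\<^esub> p" for p'
  proof -
    from that obtain i where i: "i \<in> lideal q G" "p' = i + p"
      by (auto simp: a_r_coset_def' free_alg_ops)
    have "subst nu_gen p' \<in> pideal q +>\<^bsub>free_alg UNIV\<^esub> subst nu_gen p"
      using subst_nu_lideal[OF assms(1) i(1)]
      by (auto simp: a_r_coset_def' free_alg_ops i subst_add)
    then show ?thesis
      by (intro J.a_repr_independence[symmetric]) (simp_all add: carrier_free_alg J.a_subgroup)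
  qed
  moreover have "p \<in> lideal q G +>\<^bsub>free_alg (lgens G)\<^esub> p"
    using p by (rule I.a_rcos_self)
  ultimately show ?thesis
    unfolding nu_def pideal_def[symmetric] by (intro SUP_eq_const) blast+
qed

lemma nu_gens:
  fixes q :: "'k::field"
  assumes "G \<ge> 1"
  shows "nu q (lideal q G +>\<^bsub>free_alg (lgens G)\<^esub> gen X1) = \<zero>\<^bsub>quantum_plane q\<^esub>"
    and "nu q (lideal q G +>\<^bsub>free_alg (lgens G)\<^esub> gen X2) = pideal q +>\<^bsub>free_alg UNIV\<^esub> gen X"
    and "nu q (lideal q G +>\<^bsub>free_alg (lgens G)\<^esub> gen (Z 0)) = pideal q +>\<^bsub>free_alg UNIV\<^esub> gen Y"
    and "j \<in> {1..G} \<Longrightarrow>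
      nu q (lideal q G +>\<^bsub>free_alg (lgens G)\<^esub> gen (Z j)) = \<zero>\<^bsub>quantum_plane q\<^esub>"
proof -
  have gens: "gen X1 \<in> carrier (free_alg (lgens G) :: ('k, (lgen, 'k) ncpoly) module)"
    "gen X2 \<in> carrier (free_alg (lgens G) :: ('k, (lgen, 'k) ncpoly) module)"
    "n \<le> G \<Longrightarrow> gen (Z n) \<in> carrier (free_alg (lgens G) :: ('k, (lgen, 'k) ncpoly) module)"
    for n by (auto simp: lgens_def intro!: free_alg_closed)
  have zero: "0 \<in> pideal q"
    using additive_subgroup.zero_closed[OF ideal.axioms(1)[OF ideal_pideal]]
    by (simp add: free_alg_ops)
  have "pideal q +>\<^bsub>free_alg UNIV\<^esub> 0 = pideal q"
    using zero by (rule ring.a_rcos_zero[OF ring_free_alg ideal_pideal])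
  then show "nu q (lideal q G +>\<^bsub>free_alg (lgens G)\<^esub> gen X1) = \<zero>\<^bsub>quantum_plane q\<^esub>"
    and "j \<in> {1..G} \<Longrightarrow>
      nu q (lideal q G +>\<^bsub>free_alg (lgens G)\<^esub> gen (Z j)) = \<zero>\<^bsub>quantum_plane q\<^esub>"
    by (simp_all add: nu_coset[OF assms] gens subst_gen quantum_plane_eq quot_alg_simps)
  show "nu q (lideal q G +>\<^bsub>free_alg (lgens G)\<^esub> gen X2) = pideal q +>\<^bsub>free_alg UNIV\<^esub> gen X"
    and "nu q (lideal q G +>\<^bsub>free_alg (lgens G)\<^esub> gen (Z 0)) = pideal q +>\<^bsub>free_alg UNIV\<^esub> gen Y"
    by (simp_all add: nu_coset[OF assms] gens subst_gen)
qed

lemma laistrygonian_carrierE: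
  assumes "C \<in> carrier (laistrygonian q G)"
  obtains p where "p \<in> carrier (free_alg (lgens G))"
    and "C = lideal q G +>\<^bsub>free_alg (lgens G)\<^esub> p"
  using assms by (auto simp: laistrygonian_eq quot_alg_simps A_RCOSETS_def')

lemma nu_smult:
  assumes "G \<ge> 1" and "C \<in> carrier (laistrygonian q G)"
  shows "nu q (c \<odot>\<^bsub>laistrygonian q G\<^esub> C) = c \<odot>\<^bsub>quantum_plane q\<^esub> nu q C"
  using assms(2)
  by (rule laistrygonian_carrierE)
     (simp add: laistrygonian_eq quantum_plane_eq quot_alg_smult[OF ideal_lideal]
       quot_alg_smult[OF ideal_pideal] nu_coset[OF assms(1)] free_alg_closed subst_simps
       carrier_free_alg[of _ UNIV])

lemma nu_ring_hom:
  assumes "G \<ge> 1"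
  shows "nu q \<in> ring_hom (laistrygonian q G) (quantum_plane q)"
proof -
  interpret I: ideal "lideal q G" "free_alg (lgens G)" by (rule ideal_lideal)
  interpret J: ideal "pideal q" "free_alg UNIV" by (rule ideal_pideal)
  have U: "p \<in> carrier (free_alg UNIV)" for p :: "(pgen, 'a) ncpoly"
    by (simp add: carrier_free_alg)
  show ?thesis
  proof (rule ring_hom_memI)
    fix C assume "C \<in> carrier (laistrygonian q G)"
    then obtain p where p: "p \<in> carrier (free_alg (lgens G))"
      and C: "C = lideal q G +>\<^bsub>free_alg (lgens G)\<^esub> p"
      by (rule laistrygonian_carrierE)
    show "nu q C \<in> carrier (quantum_plane q)"
      by (simp add: C nu_coset[OF assms p] quantum_plane_eq quot_alg_simps J.a_rcosetsI[OF J.a_subset] U)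
    fix D assume "D \<in> carrier (laistrygonian q G)"
    then obtain r where r: "r \<in> carrier (free_alg (lgens G))"
      and D: "D = lideal q G +>\<^bsub>free_alg (lgens G)\<^esub> r"
      by (rule laistrygonian_carrierE)
    show "nu q (C \<otimes>\<^bsub>laistrygonian q G\<^esub> D) = nu q C \<otimes>\<^bsub>quantum_plane q\<^esub> nu q D"
      using I.rcoset_mult_add[OF p r] J.rcoset_mult_add[OF U U, of "subst nu_gen p" "subst nu_gen r"]
      by (simp add: C D laistrygonian_eq quantum_plane_eq quot_alg_simps nu_coset[OF assms] p r
          free_alg_ops free_alg_closed subst_simps)
    show "nu q (C \<oplus>\<^bsub>laistrygonian q G\<^esub> D) = nu q C \<oplus>\<^bsub>quantum_plane q\<^esub> nu q D"
      using I.a_rcos_sum[OF p r] J.a_rcos_sum[OF U U, of "subst nu_gen p" "subst nu_gen r"]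
      by (simp add: C D laistrygonian_eq quantum_plane_eq quot_alg_simps nu_coset[OF assms] p r
          free_alg_ops free_alg_closed subst_simps)
  next
    show "nu q \<one>\<^bsub>laistrygonian q G\<^esub> = \<one>\<^bsub>quantum_plane q\<^esub>"
      by (simp add: laistrygonian_eq quantum_plane_eq quot_alg_simps nu_coset[OF assms]
          free_alg_ops free_alg_closed subst_simps)
  qed
qed

lemma nu_surj:
  assumes "G \<ge> 1"
  shows "nu q ` carrier (laistrygonian q G) = carrier (quantum_plane q)"
proof
  show "nu q ` carrier (laistrygonian q G) \<subseteq> carrier (quantum_plane q)"
    using ring_hom_closed[OF nu_ring_hom[OF assms]] by blast
next
  define s :: "pgen \<Rightarrow> (lgen, 'a) ncpoly" where "s = case_pgen (gen X2) (gen (Z 0))"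
  interpret I: ideal "lideal q G" "free_alg (lgens G)" by (rule ideal_lideal)
  have s: "subst s p \<in> carrier (free_alg (lgens G)) \<and> subst nu_gen (subst s p) = p" for p
  proof (induction p rule: ncpoly_induct)
    case (single k v)
    have gens: "s g \<in> carrier (free_alg (lgens G))" "subst nu_gen (s g) = gen g" for g
      by (cases g; simp add: s_def free_alg_closed lgens_def subst_gen)+
    have "prod_list (map s l) \<in> carrier (free_alg (lgens G)) \<and>
        subst nu_gen (prod_list (map s l)) = Poly_Mapping.single (Word l) 1" for l
    proof (induction l)
      case Nil
      show ?case
        using single_one by (simp add: free_alg_closed subst_simps zero_word_def[symmetric])
    next
      case (Cons g l)
      then show ?case
        by (simp add: free_alg_closed subst_simps gens gen_def mult_single plus_word_def)
    qed
    then show ?case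
      by (simp add: subst_single free_alg_closed subst_simps)
         (simp add: const_def mult_single)
  qed (simp_all add: free_alg_closed subst_simps)
  show "carrier (quantum_plane q) \<subseteq> nu q ` carrier (laistrygonian q G)"
  proof
    fix D assume "D \<in> carrier (quantum_plane q)"
    then obtain p where "D = pideal q +>\<^bsub>free_alg UNIV\<^esub> p"
      by (auto simp: quantum_plane_eq quot_alg_simps A_RCOSETS_def')
    then have "D = nu q (lideal q G +>\<^bsub>free_alg (lgens G)\<^esub> subst s p)"
      using s[of p] by (simp add: nu_coset[OF assms])
    moreover have "lideal q G +>\<^bsub>free_alg (lgens G)\<^esub> subst s p \<in> carrier (laistrygonian q G)"
      using s[of p] by (simp add: laistrygonian_eq quot_alg_simps I.a_rcosetsI[OF I.a_subset])
    ultimately show "D \<in> nu q ` carrier (laistrygonian q G)" by blast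
  qed
qed

end

theory Submission
  imports Defs
begin

text \<open>
  It suffices that the kernel of \<open>\<nu>\<^sub>G\<close>, generated by \<open>x\<^sub>1, z\<^sub>1, \<dots>, z\<^sub>G\<close>, annihilates every
  finite-dimensional simple module. An element \<open>z\<close> normalizing the image of the algebra acts on
  such a module as zero or invertibly, since its kernel and image are submodules. The element
  \<open>x\<^sub>1\<close> is of this kind, and if it were invertible, then \<open>[x\<^sub>2, 2 x\<^sub>1\<^sup>-\<^sup>1] = 1\<close>, which is impossible
  in characteristic \<open>0\<close> by comparing traces. Likewise the \<open>z\<^sub>n\<close> turn out to commute up to nonzero
  scalars, so that once \<open>z\<^sub>n = 0\<close> for all \<open>n > m\<close>, the element \<open>z\<^sub>m\<close> acts normally; if it were
  invertible and \<open>m \<ge> 1\<close>, then \<open>[x\<^sub>2, z\<^sub>m\<^sub>-\<^sub>1 z\<^sub>m\<^sup>-\<^sup>1] = 1\<close>.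
\<close>

section \<open>Pulling back along a surjective algebra map\<close>

lemma isomorphic_refl: "isomorphic A M M"
  unfolding isomorphic_def by (rule exI[of _ id]) simp

text \<open>Inverting \<open>h\<close> on a sum or a multiple requires the carrier of
  \<open>M\<close> to be closed under both, hence the module hypothesis on \<open>M\<close>.\<close>

lemma isomorphic_sym:
  assumes M: "left_module A M" and iso: "isomorphic A M N"
  shows "isomorphic A N M"
proof -
  interpret M: left_module A M by (rule M)
  obtain h where h: "bij_betw h (carrier M) (carrier N)"
    "\<And>x y. x \<in> carrier M \<Longrightarrow> y \<in> carrier M \<Longrightarrow> h (x \<oplus>\<^bsub>M\<^esub> y) = h x \<oplus>\<^bsub>N\<^esub> h y"
    "\<And>a x. a \<in> carrier A \<Longrightarrow> x \<in> carrier M \<Longrightarrow> h (a \<odot>\<^bsub>M\<^esub> x) = a \<odot>\<^bsub>N\<^esub> h x"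
    using iso unfolding isomorphic_def by blast
  let ?k = "inv_into (carrier M) h"
  have k: "?k y \<in> carrier M" "h (?k y) = y" if "y \<in> carrier N" for y
    using bij_betw_inv_into_right[OF h(1) that] bij_betwE[OF bij_betw_inv_into[OF h(1)]] that by auto
  have eq: "?k y = x" if "x \<in> carrier M" "h x = y" for x y
    using bij_betw_inv_into_left[OF h(1) that(1)] that(2) by simp
  show ?thesis
    unfolding isomorphic_def
    using bij_betw_inv_into[OF h(1)]
    by (intro exI[of _ ?k] conjI ballI eq) (simp_all add: h k M.smult_closed)
qed

lemma isomorphic_trans:
  assumes "isomorphic A M N" "isomorphic A N P"
  shows "isomorphic A M P"
proof -
  obtain h where h: "bij_betw h (carrier M) (carrier N)"
    "\<And>x y. x \<in> carrier M \<Longrightarrow> y \<in> carrier M \<Longrightarrow> h (x \<oplus>\<^bsub>M\<^esub> y) = h x \<oplus>\<^bsub>N\<^esub> h y"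
    "\<And>a x. a \<in> carrier A \<Longrightarrow> x \<in> carrier M \<Longrightarrow> h (a \<odot>\<^bsub>M\<^esub> x) = a \<odot>\<^bsub>N\<^esub> h x"
    using assms(1) unfolding isomorphic_def by blast
  obtain k where k: "bij_betw k (carrier N) (carrier P)"
    "\<And>x y. x \<in> carrier N \<Longrightarrow> y \<in> carrier N \<Longrightarrow> k (x \<oplus>\<^bsub>N\<^esub> y) = k x \<oplus>\<^bsub>P\<^esub> k y"
    "\<And>a x. a \<in> carrier A \<Longrightarrow> x \<in> carrier N \<Longrightarrow> k (a \<odot>\<^bsub>N\<^esub> x) = a \<odot>\<^bsub>P\<^esub> k x"
    using assms(2) unfolding isomorphic_def by blast
  have "h x \<in> carrier N" if "x \<in> carrier M" for x using bij_betwE[OF h(1)] that by blast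
  with h k show ?thesis
    unfolding isomorphic_def
    by (intro exI[of _ "k \<circ> h"] conjI ballI bij_betw_trans[OF h(1) k(1)]) simp_all
qed

lemma equiv_iso_rel: "equiv (fd_simple A) (iso_rel A)"
proof (rule equivI)
  show "refl_on (fd_simple A) (iso_rel A)"
    by (auto simp: refl_on_def iso_rel_def isomorphic_refl)
  show "sym (iso_rel A)"
    by (auto simp: sym_def iso_rel_def fd_simple_def simple_module_def intro: isomorphic_sym)
  show "trans (iso_rel A)"
    by (auto simp: trans_def iso_rel_def intro: isomorphic_trans)
qed (auto simp: iso_rel_def)

text \<open>The base field acts on modules through multiples of one, so compatibility with scalars
  is stated for these.\<close>

locale surjective_algebra_map =
  fixes A :: "('k, 'a) module" and B :: "('k, 'b) module" and f :: "'a \<Rightarrow> 'b"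
  assumes ring_A: "ring A" and ring_B: "ring B"
    and hom: "f \<in> ring_hom A B" and surj: "f ` carrier A = carrier B"
    and f_scalar: "f (c \<odot>\<^bsub>A\<^esub> \<one>\<^bsub>A\<^esub>) = c \<odot>\<^bsub>B\<^esub> \<one>\<^bsub>B\<^esub>"
    and scalar_closed: "c \<odot>\<^bsub>A\<^esub> \<one>\<^bsub>A\<^esub> \<in> carrier A"
begin

text \<open>A relation rather than a function, because a module that factors through
  \<open>f\<close> agrees with a pullback only on its carrier; its record may differ
  elsewhere.\<close>

definition pulls_back_to :: "('b, 'v) module \<Rightarrow> ('a, 'v) module \<Rightarrow> bool" where
  "pulls_back_to N M \<longleftrightarrow> carrier N = carrier M \<and> zero N = zero M \<and> add N = add M \<and>
     (\<forall>a \<in> carrier A. \<forall>v \<in> carrier M. a \<odot>\<^bsub>M\<^esub> v = f a \<odot>\<^bsub>N\<^esub> v)"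

lemma pulls_back_to_pullback: "pulls_back_to N (pullback f N)"
  by (simp add: pulls_back_to_def pullback_def)

lemma f_closed: "a \<in> carrier A \<Longrightarrow> f a \<in> carrier B"
  using surj by blast

lemma left_module_pulls_back:
  assumes "pulls_back_to N M" "left_module B N"
  shows "left_module A M"
proof -
  interpret N: left_module B N by fact
  have eq: "carrier M = carrier N" "zero M = zero N" "add M = add N"
    "\<And>a v. a \<in> carrier A \<Longrightarrow> v \<in> carrier N \<Longrightarrow> a \<odot>\<^bsub>M\<^esub> v = f a \<odot>\<^bsub>N\<^esub> v"
    using assms(1) by (auto simp: pulls_back_to_def)
  interpret A: ring A by (rule ring_A)
  have "abelian_group M"
    by (rule abelian_groupI) (auto simp: eq N.M.a_ac intro: N.M.add.l_inv_ex)
  then show ?thesis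
    by (intro left_module.intro left_module_axioms.intro ring_A)
       (simp_all add: eq f_closed N.smult_closed N.smult_l_distr N.smult_r_distr N.smult_assoc
         N.smult_one ring_hom_add[OF hom] ring_hom_mult[OF hom] ring_hom_one[OF hom])
qed

text \<open>By surjectivity every element of \<open>B\<close> acts as some element of
  \<open>A\<close>, so stability under \<open>A\<close> and under \<open>B\<close> coincide. This
  transfers simplicity.\<close>

lemma submodule_pulls_back:
  assumes "pulls_back_to N M"
  shows "submodule K A M \<longleftrightarrow> submodule K B N"
proof -
  have eq: "carrier M = carrier N" "zero M = zero N" "add M = add N"
    "\<And>a v. a \<in> carrier A \<Longrightarrow> v \<in> carrier N \<Longrightarrow> a \<odot>\<^bsub>M\<^esub> v = f a \<odot>\<^bsub>N\<^esub> v"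
    using assms by (auto simp: pulls_back_to_def)
  have group: "subgroup K (add_monoid M) \<longleftrightarrow> subgroup K (add_monoid N)"
    by (simp add: subgroup_def m_inv_def eq)
  have "submodule_axioms K A M \<longleftrightarrow> submodule_axioms K B N" if "subgroup K (add_monoid N)"
  proof -
    have "v \<in> carrier N" if "v \<in> K" for v
      using subgroup.subset[OF \<open>subgroup K (add_monoid N)\<close>] that by auto
    then have "submodule_axioms K A M \<longleftrightarrow> (\<forall>a\<in>carrier A. \<forall>v\<in>K. f a \<odot>\<^bsub>N\<^esub> v \<in> K)"
      by (auto simp: submodule_axioms_def eq(4))
    also have "\<dots> \<longleftrightarrow> (\<forall>b\<in>f ` carrier A. \<forall>v\<in>K. b \<odot>\<^bsub>N\<^esub> v \<in> K)" by blast
    also have "\<dots> \<longleftrightarrow> submodule_axioms K B N"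
      unfolding surj submodule_axioms_def by blast
    finally show ?thesis .
  qed
  with group show ?thesis unfolding submodule_def by blast
qed

lemma finite_dim_pulls_back:
  assumes "pulls_back_to N M" "left_module B N"
  shows "finite_dim A M \<longleftrightarrow> finite_dim B N"
proof -
  interpret N: left_module B N by fact
  have eq: "carrier M = carrier N" "zero M = zero N" "add M = add N"
    "\<And>a v. a \<in> carrier A \<Longrightarrow> v \<in> carrier N \<Longrightarrow> a \<odot>\<^bsub>M\<^esub> v = f a \<odot>\<^bsub>N\<^esub> v"
    using assms(1) by (auto simp: pulls_back_to_def)
  have "(\<Oplus>\<^bsub>M\<^esub>s\<in>S. (c s \<odot>\<^bsub>A\<^esub> \<one>\<^bsub>A\<^esub>) \<odot>\<^bsub>M\<^esub> s) = (\<Oplus>\<^bsub>N\<^esub>s\<in>S. (c s \<odot>\<^bsub>B\<^esub> \<one>\<^bsub>B\<^esub>) \<odot>\<^bsub>N\<^esub> s)"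
    if "S \<subseteq> carrier N" for S c
  proof -
    \<comment> \<open>A finite sum depends only on the carrier, zero and addition of the module,
      which \<open>M\<close> and \<open>N\<close> share.\<close>
    have "(\<Oplus>\<^bsub>M\<^esub>s\<in>S. (c s \<odot>\<^bsub>A\<^esub> \<one>\<^bsub>A\<^esub>) \<odot>\<^bsub>M\<^esub> s) = (\<Oplus>\<^bsub>N\<^esub>s\<in>S. (c s \<odot>\<^bsub>A\<^esub> \<one>\<^bsub>A\<^esub>) \<odot>\<^bsub>M\<^esub> s)"
      by (simp add: finsum_def finprod_def eq)
    also have "\<dots> = (\<Oplus>\<^bsub>N\<^esub>s\<in>S. (c s \<odot>\<^bsub>B\<^esub> \<one>\<^bsub>B\<^esub>) \<odot>\<^bsub>N\<^esub> s)"
      using that f_closed[OF scalar_closed]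
      by (intro N.M.finsum_cong') (auto simp: eq(4) scalar_closed f_scalar intro!: N.smult_closed)
    finally show ?thesis .
  qed
  then show ?thesis
    unfolding finite_dim_def eq(1) by (intro ex_cong conj_cong refl) simp
qed

lemma fd_simple_pulls_back:
  assumes "pulls_back_to N M" "left_module B N"
  shows "M \<in> fd_simple A \<longleftrightarrow> N \<in> fd_simple B"
proof -
  have "carrier M = carrier N" "zero M = zero N"
    using assms(1) by (auto simp: pulls_back_to_def)
  then show ?thesis
    using assms submodule_pulls_back[OF assms(1)] left_module_pulls_back[OF assms]
      finite_dim_pulls_back[OF assms]
    by (simp add: fd_simple_def simple_module_def)
qed

lemma fd_simple_pullback: "N \<in> fd_simple B \<Longrightarrow> pullback f N \<in> fd_simple A"
  using fd_simple_pulls_back[OF pulls_back_to_pullback]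
  by (auto simp: fd_simple_def simple_module_def)

text \<open>The same bijections serve on both sides: by surjectivity, linearity over
  \<open>A\<close> through \<open>f\<close> is linearity over \<open>B\<close>.\<close>

lemma isomorphic_pullback_iff:
  "isomorphic A (pullback f N) (pullback f P) \<longleftrightarrow> isomorphic B N P"
  unfolding isomorphic_def pullback_def surj[symmetric] by simp

lemma iso_rel_pullback_iff:
  assumes "N \<in> fd_simple B" "P \<in> fd_simple B"
  shows "(pullback f N, pullback f P) \<in> iso_rel A \<longleftrightarrow> (N, P) \<in> iso_rel B"
  using assms by (simp add: iso_rel_def isomorphic_pullback_iff fd_simple_pullback)

lemma pullback_class_respects: "pullback_class A f respects iso_rel B"
proof (rule congruentI)
  fix N P assume NP: "(N, P) \<in> iso_rel B"
  then have "N \<in> fd_simple B" "P \<in> fd_simple B" by (auto simp: iso_rel_def)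
  with NP show "pullback_class A f N = pullback_class A f P"
    unfolding pullback_class_def by (intro equiv_class_eq[OF equiv_iso_rel]) (simp add: iso_rel_pullback_iff)
qed

text \<open>An element of \<open>B\<close> acts through any preimage; two preimages differ by an
  element of the kernel, which acts as zero.\<close>

lemma factors_throughI:
  assumes M: "left_module A M"
    and kills: "\<And>a v. \<lbrakk>a \<in> carrier A; f a = \<zero>\<^bsub>B\<^esub>; v \<in> carrier M\<rbrakk> \<Longrightarrow> a \<odot>\<^bsub>M\<^esub> v = \<zero>\<^bsub>M\<^esub>"
  shows "factors_through A B f M"
proof -
  interpret M: left_module A M by (rule M)
  interpret B: ring B by (rule ring_B)
  interpret H: ring_hom_ring A B f
    by (rule ring_hom_ringI2[OF ring_A ring_B hom])
  have same: "a \<odot>\<^bsub>M\<^esub> v = b \<odot>\<^bsub>M\<^esub> v"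
    if "a \<in> carrier A" "b \<in> carrier A" "f a = f b" "v \<in> carrier M" for a b v
  proof -
    have "(a \<ominus>\<^bsub>A\<^esub> b) \<odot>\<^bsub>M\<^esub> v = \<zero>\<^bsub>M\<^esub>"
      using that by (intro kills) (auto simp: M.R.minus_eq B.r_neg)
    moreover have "a = (a \<ominus>\<^bsub>A\<^esub> b) \<oplus>\<^bsub>A\<^esub> b"
      using that by (simp add: M.R.minus_eq M.R.a_assoc M.R.l_neg)
    ultimately show ?thesis
      using that M.smult_l_distr[of "a \<ominus>\<^bsub>A\<^esub> b" b v] M.smult_closed by simp
  qed
  \<comment> \<open>\<open>g\<close> is a merely set-theoretic section of \<open>f\<close>. Its
    failure to respect sums, products and one is invisible on \<open>M\<close> by
    \<open>same\<close>.\<close>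
  define g where "g = inv_into (carrier A) f"
  have g: "g b \<in> carrier A" "f (g b) = b" if "b \<in> carrier B" for b
    using that surj by (auto simp: g_def inv_into_into f_inv_into_f)
  define N where "N = \<lparr>carrier = carrier M, mult = mult M, one = one M, zero = zero M, add = add M,
    smult = (\<lambda>b v. g b \<odot>\<^bsub>M\<^esub> v)\<rparr>"
  have N: "carrier N = carrier M" "zero N = zero M" "add N = add M"
    "smult N = (\<lambda>b v. g b \<odot>\<^bsub>M\<^esub> v)" by (simp_all add: N_def)
  have "abelian_group N"
    by (rule abelian_groupI) (auto simp: N M.M.a_ac intro: M.M.add.l_inv_ex)
  moreover have "left_module_axioms B N"
  proof (unfold_locales, unfold N)
    fix a b v assume a: "a \<in> carrier B" and v: "v \<in> carrier M"
    show "g a \<odot>\<^bsub>M\<^esub> v \<in> carrier M" using g a v by (simp add: M.smult_closed)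
    show "g a \<odot>\<^bsub>M\<^esub> (v \<oplus>\<^bsub>M\<^esub> w) = g a \<odot>\<^bsub>M\<^esub> v \<oplus>\<^bsub>M\<^esub> g a \<odot>\<^bsub>M\<^esub> w" if "w \<in> carrier M" for w
      using g a v that by (simp add: M.smult_r_distr)
    assume b: "b \<in> carrier B"
    show "g (a \<oplus>\<^bsub>B\<^esub> b) \<odot>\<^bsub>M\<^esub> v = g a \<odot>\<^bsub>M\<^esub> v \<oplus>\<^bsub>M\<^esub> g b \<odot>\<^bsub>M\<^esub> v"
      using g a b v same[of "g (a \<oplus>\<^bsub>B\<^esub> b)" "g a \<oplus>\<^bsub>A\<^esub> g b" v] by (simp add: M.smult_l_distr)
    show "g (a \<otimes>\<^bsub>B\<^esub> b) \<odot>\<^bsub>M\<^esub> v = g a \<odot>\<^bsub>M\<^esub> (g b \<odot>\<^bsub>M\<^esub> v)"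
      using g a b v same[of "g (a \<otimes>\<^bsub>B\<^esub> b)" "g a \<otimes>\<^bsub>A\<^esub> g b" v] by (simp add: M.smult_assoc)
  next
    fix v assume "v \<in> carrier M"
    then show "g \<one>\<^bsub>B\<^esub> \<odot>\<^bsub>M\<^esub> v = v"
      using g same[of "g \<one>\<^bsub>B\<^esub>" "\<one>\<^bsub>A\<^esub>" v] by (simp add: M.smult_one)
  qed
  ultimately have "left_module B N" by (intro left_module.intro ring_B)
  moreover have "a \<odot>\<^bsub>M\<^esub> v = f a \<odot>\<^bsub>N\<^esub> v" if "a \<in> carrier A" "v \<in> carrier M" for a v
    using that g[OF f_closed] by (auto simp: N intro: same)
  ultimately show ?thesis
    unfolding factors_through_def using N by blast
qed

text \<open>Injectivity holds because pulling back reflects isomorphism, surjectivity because every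
  simple \<open>M\<close> descends to a module over \<open>B\<close>, which is again simple.\<close>

lemma bij_betw_pullback_class:
  assumes factor: "\<And>M :: ('a, 'v) module. M \<in> fd_simple A \<Longrightarrow> factors_through A B f M"
  shows "bij_betw (\<lambda>C. \<Union>N\<in>C. pullback_class A f N)
    (irrep B :: ('b, 'v) module set set) (irrep A :: ('a, 'v) module set set)"
proof -
  let ?F = "\<lambda>C. \<Union>N\<in>C. pullback_class A f N"
  have F: "?F (iso_rel B `` {N}) = iso_rel A `` {pullback f N}" if "N \<in> fd_simple B" for N :: "('b, 'v) module"
    using UN_equiv_class[OF equiv_iso_rel pullback_class_respects that]
    by (simp add: pullback_class_def)
  show ?thesis
  proof (rule bij_betw_imageI)
    show "inj_on ?F (irrep B :: ('b, 'v) module set set)"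
    proof (rule inj_onI)
      fix C D :: "('b, 'v) module set"
      assume C: "C \<in> irrep B" and D: "D \<in> irrep B" and eq: "?F C = ?F D"
      obtain N where N: "N \<in> fd_simple B" "C = iso_rel B `` {N}"
        using C unfolding irrep_def by (rule quotientE)
      obtain P where P: "P \<in> fd_simple B" "D = iso_rel B `` {P}"
        using D unfolding irrep_def by (rule quotientE)
      from eq have "(pullback f N, pullback f P) \<in> iso_rel A"
        unfolding N(2) P(2) F[OF N(1)] F[OF P(1)]
        by (rule eq_equiv_class[OF _ equiv_iso_rel fd_simple_pullback[OF P(1)]])
      then show "C = D"
        unfolding N(2) P(2)
        by (intro equiv_class_eq[OF equiv_iso_rel]) (simp add: iso_rel_pullback_iff N P)
    qed
    show "?F ` irrep B = (irrep A :: ('a, 'v) module set set)"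
    proof (intro equalityI subsetI)
      fix D :: "('a, 'v) module set" assume "D \<in> ?F ` irrep B"
      then obtain C where C: "C \<in> irrep B" "D = ?F C" by (rule imageE)
      obtain N where N: "N \<in> fd_simple B" "C = iso_rel B `` {N}"
        using C(1) unfolding irrep_def by (rule quotientE)
      show "D \<in> irrep A"
        unfolding irrep_def C(2) N(2) F[OF N(1)] by (rule quotientI[OF fd_simple_pullback[OF N(1)]])
    next
      fix D :: "('a, 'v) module set" assume "D \<in> irrep A"
      then obtain M where M: "M \<in> fd_simple A" "D = iso_rel A `` {M}"
        unfolding irrep_def by (rule quotientE)
      obtain N where N: "left_module B N" "pulls_back_to N M"
        using factor[OF M(1)] unfolding factors_through_def pulls_back_to_def by blast
      then have fd: "N \<in> fd_simple B" using M(1) fd_simple_pulls_back by blast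
      \<comment> \<open>\<open>M\<close> and \<open>pullback f N\<close> may differ as records, but
        the identity is an isomorphism between them.\<close>
      have "isomorphic A M (pullback f N)"
        using N(2) unfolding isomorphic_def pulls_back_to_def
        by (intro exI[of _ id]) (simp add: pullback_def)
      with M fd have "iso_rel A `` {M} = iso_rel A `` {pullback f N}"
        by (intro equiv_class_eq[OF equiv_iso_rel]) (simp add: iso_rel_def fd_simple_pullback)
      then have "D = ?F (iso_rel B `` {N})" unfolding M(2) F[OF fd] .
      moreover have "iso_rel B `` {N} \<in> irrep B"
        unfolding irrep_def using fd by (rule quotientI)
      ultimately show "D \<in> ?F ` irrep B" by (rule image_eqI)
    qed
  qed
qed

end

section \<open>Representations of free algebras\<close>

text \<open>Every monomial is a scalar multiplied on the right by generators, one after the other;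
  hence the induction from the end of the word.\<close>

lemma ncpoly_gen_induct [case_names const gen add mult]:
  fixes p :: "('g, 'k::field) ncpoly"
  assumes const: "\<And>c. P (const c)" and gen: "\<And>g. P (gen g)"
    and add: "\<And>p r. P p \<Longrightarrow> P r \<Longrightarrow> P (p + r)" and mult: "\<And>p r. P p \<Longrightarrow> P r \<Longrightarrow> P (p * r)"
  shows "P p"
proof (induction p rule: ncpoly_induct)
  case zero
  show ?case using const[of 0] by (simp add: const_def)
next
  case (single w c)
  have "P (Poly_Mapping.single (Word l) c)" for l
  proof (induction l rule: rev_induct)
    case Nil
    show ?case using const[of c] by (simp add: const_def zero_word_def)
  next
    case (snoc g l)
    have "Poly_Mapping.single (Word (l @ [g])) c = Poly_Mapping.single (Word l) c * gen g"
      by (simp add: gen_def mult_single plus_word_def)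
    then show ?case using mult[OF snoc gen] by simp
  qed
  then show ?case by (metis word.exhaust)
qed (rule add)

text \<open>A representation of the free algebra on all letters. Computations then take place in the
  ring type of polynomials instead of the record of cosets; of \<open>M\<close> only the additive
  group enters.\<close>

locale ncpoly_rep = abelian_group M for M :: "('v, 'm) ring_scheme" (structure) +
  fixes act :: "('g, 'k::field) ncpoly \<Rightarrow> 'v \<Rightarrow> 'v"
  assumes act_closed [simp, intro]: "v \<in> carrier M \<Longrightarrow> act p v \<in> carrier M"
    and act_add_left: "v \<in> carrier M \<Longrightarrow> act (p + r) v = act p v \<oplus> act r v"
    and act_add_right: "\<lbrakk>v \<in> carrier M; w \<in> carrier M\<rbrakk> \<Longrightarrow> act p (v \<oplus> w) = act p v \<oplus> act p w"
    and act_mult: "v \<in> carrier M \<Longrightarrow> act (p * r) v = act p (act r v)"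
    and act_one [simp]: "v \<in> carrier M \<Longrightarrow> act 1 v = v"
begin

lemma act_zero_right [simp]: "act p \<zero> = \<zero>"
  using act_add_right[of \<zero> \<zero> p] add.l_cancel_one by force

lemma act_zero_left [simp]: "v \<in> carrier M \<Longrightarrow> act 0 v = \<zero>"
  using act_add_left[of v 0 0] add.l_cancel_one by force

lemma act_uminus_left: "v \<in> carrier M \<Longrightarrow> act (- p) v = \<ominus> act p v"
  using act_add_left[of v "- p" p] by (simp add: minus_equality)

text \<open>Identities between operators are written as membership of a difference in this two-sided
  ideal, so that they can be multiplied and added as polynomials.\<close>

definition ann :: "('g, 'k) ncpoly set" where
  "ann = {p. \<forall>v \<in> carrier M. act p v = \<zero>}"

lemma ann_zero: "0 \<in> ann"
  by (simp add: ann_def)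

lemma ann_add: "p \<in> ann \<Longrightarrow> r \<in> ann \<Longrightarrow> p + r \<in> ann"
  by (simp add: ann_def act_add_left)

lemma ann_uminus: "p \<in> ann \<Longrightarrow> - p \<in> ann"
  by (simp add: ann_def act_uminus_left)

lemma ann_diff: "p \<in> ann \<Longrightarrow> r \<in> ann \<Longrightarrow> p - r \<in> ann"
  using ann_add[of p "- r"] ann_uminus[of r] by simp

lemma ann_mult_left: "r \<in> ann \<Longrightarrow> p * r \<in> ann"
  by (simp add: ann_def act_mult)

lemma ann_mult_right: "p \<in> ann \<Longrightarrow> p * r \<in> ann"
  by (simp add: ann_def act_mult)

lemmas ann_closed = ann_zero ann_add ann_uminus ann_diff ann_mult_left ann_mult_right

lemma act_cong:
  assumes "p - r \<in> ann" and "v \<in> carrier M"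
  shows "act p v = act r v"
  using assms act_add_left[of v "p - r" r] by (simp add: ann_def)

section \<open>Linear combinations and bases\<close>

definition lin_comb :: "'v set \<Rightarrow> ('v \<Rightarrow> 'k) \<Rightarrow> 'v" where
  "lin_comb T c = (\<Oplus>s\<in>T. act (const (c s)) s)"

definition spanning :: "'v set \<Rightarrow> bool" where
  "spanning S \<longleftrightarrow> finite S \<and> S \<subseteq> carrier M \<and> (\<forall>v \<in> carrier M. \<exists>c. v = lin_comb S c)"

lemma lin_comb_closed [simp, intro]: "T \<subseteq> carrier M \<Longrightarrow> lin_comb T c \<in> carrier M"
  unfolding lin_comb_def by (rule finsum_closed) auto

lemma lin_comb_empty [simp]: "lin_comb {} c = \<zero>"
  by (simp add: lin_comb_def)

lemma lin_comb_insert: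
  assumes "finite T" "s \<notin> T" "insert s T \<subseteq> carrier M"
  shows "lin_comb (insert s T) c = act (const (c s)) s \<oplus> lin_comb T c"
  unfolding lin_comb_def by (rule finsum_insert) (use assms in auto)

lemma lin_comb_cong:
  assumes "T \<subseteq> carrier M" "\<And>s. s \<in> T \<Longrightarrow> c s = d s"
  shows "lin_comb T c = lin_comb T d"
  unfolding lin_comb_def by (rule finsum_cong') (use assms in auto)

lemma lin_comb_add:
  assumes "T \<subseteq> carrier M"
  shows "lin_comb T (\<lambda>s. c s + d s) = lin_comb T c \<oplus> lin_comb T d"
proof -
  have "lin_comb T (\<lambda>s. c s + d s) = (\<Oplus>s\<in>T. act (const (c s)) s \<oplus> act (const (d s)) s)"
    unfolding lin_comb_def by (rule finsum_cong') (use assms in \<open>auto simp: const_add act_add_left\<close>)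
  also have "\<dots> = lin_comb T c \<oplus> lin_comb T d"
    unfolding lin_comb_def by (rule finsum_addf) (use assms in auto)
  finally show ?thesis .
qed

lemma lin_comb_zero: "finite T \<Longrightarrow> T \<subseteq> carrier M \<Longrightarrow> lin_comb T (\<lambda>_. 0) = \<zero>"
  by (induction T rule: finite_induct) (auto simp: lin_comb_insert const_def)

lemma lin_comb_smult:
  assumes "finite T" "T \<subseteq> carrier M"
  shows "lin_comb T (\<lambda>s. k * c s) = act (const k) (lin_comb T c)"
  using assms
  by (induction T rule: finite_induct)
     (auto simp: lin_comb_insert act_add_right const_mult act_mult)

lemma lin_comb_mono_neutral:
  assumes "finite S" "T \<subseteq> S" "S \<subseteq> carrier M" "\<And>s. s \<in> S - T \<Longrightarrow> c s = 0"
  shows "lin_comb S c = lin_comb T c"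
  unfolding lin_comb_def
  by (rule add.finprod_mono_neutral_cong_left[symmetric])
     (use assms in \<open>auto simp: const_def\<close>)

lemma lin_comb_unit:
  assumes "finite S" "S \<subseteq> carrier M" "s \<in> S"
  shows "lin_comb S (\<lambda>u. if u = s then 1 else 0) = s"
proof -
  have "lin_comb S (\<lambda>u. if u = s then 1 else 0) = lin_comb {s} (\<lambda>u. if u = s then 1 else 0)"
    by (rule lin_comb_mono_neutral) (use assms in auto)
  also have "\<dots> = s"
    using assms single_one by (subst lin_comb_insert) (auto simp: const_def)
  finally show ?thesis .
qed

lemma lin_comb_diff_eq_zero:
  assumes "finite S" "S \<subseteq> carrier M" "lin_comb S c = lin_comb S d"
  shows "lin_comb S (\<lambda>s. c s - d s) = \<zero>"
proof -
  have "lin_comb S d = lin_comb S (\<lambda>s. c s - d s) \<oplus> lin_comb S d"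
    using lin_comb_add[OF assms(2), of "\<lambda>s. c s - d s" d] assms(3) by simp
  then show ?thesis
    using assms(2) add.r_cancel_one' by auto
qed

text \<open>A spanning set of least cardinality is independent, since a nontrivial relation would
  allow one of its elements to be dropped.\<close>

lemma basis_exists:
  assumes "spanning S"
  obtains T where "spanning T"
    and "\<And>c d s. lin_comb T c = lin_comb T d \<Longrightarrow> s \<in> T \<Longrightarrow> c s = d s"
proof -
  obtain T where T: "spanning T" and min: "\<And>U. spanning U \<Longrightarrow> card T \<le> card U"
    using ex_has_least_nat[of spanning S card] assms by blast
  then have fin: "finite T" and sub: "T \<subseteq> carrier M" by (auto simp: spanning_def)
  have indep: "d t = 0" if d: "lin_comb T d = \<zero>" and t: "t \<in> T" for d t
  proof (rule ccontr)
    assume dt: "d t \<noteq> 0"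
    have "\<exists>c. v = lin_comb (T - {t}) c" if v: "v \<in> carrier M" for v
    proof -
      obtain c where c: "v = lin_comb T c" using T v unfolding spanning_def by blast
      \<comment> \<open>This \<open>k\<close> makes the coefficient of \<open>t\<close> in
        \<open>c + k d\<close> vanish, while adding \<open>k\<close> times the relation
        \<open>d\<close> does not change \<open>v\<close>.\<close>
      define k where "k = - (c t / d t)"
      let ?e = "\<lambda>s. c s + k * d s"
      have "lin_comb T ?e = v \<oplus> act (const k) \<zero>"
        by (simp only: lin_comb_add[OF sub] lin_comb_smult[OF fin sub] d c)
      also have "\<dots> = v" using v by simp
      finally show ?thesis
        using lin_comb_mono_neutral[OF fin _ sub, of "T - {t}" ?e] dt t by (force simp: k_def)
    qed
    then have "spanning (T - {t})" using fin sub by (auto simp: spanning_def)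
    from min[OF this] show False using fin t by (metis card_Diff1_less not_less)
  qed
  show thesis
  proof (rule that[OF T])
    fix c d s assume "lin_comb T c = lin_comb T d" "s \<in> T"
    then show "c s = d s"
      using indep[OF lin_comb_diff_eq_zero[OF fin sub]] by fastforce
  qed
qed

section \<open>Linear maps, matrices and traces\<close>

definition linear_map :: "('v \<Rightarrow> 'v) \<Rightarrow> bool" where
  "linear_map f \<longleftrightarrow> f \<in> carrier M \<rightarrow> carrier M \<and>
     (\<forall>v \<in> carrier M. \<forall>w \<in> carrier M. f (v \<oplus> w) = f v \<oplus> f w) \<and>
     (\<forall>c. \<forall>v \<in> carrier M. f (act (const c) v) = act (const c) (f v))"

lemma linear_map_act: "linear_map (act p)"
  by (simp add: linear_map_def act_add_right flip: act_mult const_comm)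

lemma linear_map_comp: "linear_map f \<Longrightarrow> linear_map g \<Longrightarrow> linear_map (\<lambda>v. f (g v))"
  by (auto simp: linear_map_def Pi_iff)

lemma linear_map_inv:
  assumes "linear_map f" and bij: "bij_betw f (carrier M) (carrier M)"
  shows "linear_map (inv_into (carrier M) f)"
proof -
  have f: "f v \<in> carrier M" "f (act (const c) v) = act (const c) (f v)"
    "w \<in> carrier M \<Longrightarrow> f (v \<oplus> w) = f v \<oplus> f w"
    if "v \<in> carrier M" for v w c using assms(1) that by (auto simp: linear_map_def)
  note fi = bij_betw_inv_into_right[OF bij] bij_betwE[OF bij_betw_inv_into[OF bij], rule_format]
  have eq: "inv_into (carrier M) f v = w" if "w \<in> carrier M" "f w = v" for v w
    using bij that by (metis bij_betw_inv_into_left)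
  show ?thesis
    unfolding linear_map_def by (auto intro!: eq simp: f fi)
qed

lemma linear_map_zero:
  assumes "linear_map f"
  shows "f \<zero> = \<zero>"
proof -
  have "f \<zero> \<in> carrier M" and "\<And>v w. \<lbrakk>v \<in> carrier M; w \<in> carrier M\<rbrakk> \<Longrightarrow> f (v \<oplus> w) = f v \<oplus> f w"
    using assms by (auto simp: linear_map_def Pi_iff)
  then have "f \<zero> \<in> carrier M" "f \<zero> \<oplus> f \<zero> = f \<zero>"
    by (simp, metis l_zero zero_closed)
  then show ?thesis by simp
qed

text \<open>The column of the matrix \<open>F\<close> at \<open>t\<close> expands
  \<open>f t\<close>. The separate set \<open>T\<close> lets the induction run over the summands
  while the basis \<open>S\<close> stays fixed.\<close>

lemma linear_map_lin_comb:
  assumes f: "linear_map f" and S: "S \<subseteq> carrier M" "finite S" and "T \<subseteq> S"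
    and F: "\<And>t. t \<in> T \<Longrightarrow> f t = lin_comb S (\<lambda>u. F u t)"
  shows "f (lin_comb T c) = lin_comb S (\<lambda>u. \<Sum>t\<in>T. F u t * c t)"
proof -
  have "finite T" using assms finite_subset by blast
  then show ?thesis using \<open>T \<subseteq> S\<close> F
  proof (induction T rule: finite_induct)
    case empty
    show ?case using f S by (simp add: linear_map_zero lin_comb_zero)
  next
    case (insert t T)
    have t: "t \<in> carrier M" and T: "insert t T \<subseteq> carrier M" using insert S by auto
    have "f (lin_comb (insert t T) c) = act (const (c t)) (f t) \<oplus> f (lin_comb T c)"
      using f t T insert by (auto simp: lin_comb_insert linear_map_def)
    also have "\<dots> = lin_comb S (\<lambda>u. c t * F u t + (\<Sum>s\<in>T. F u s * c s))"
      using insert S by (simp add: lin_comb_add lin_comb_smult)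
    also have "\<dots> = lin_comb S (\<lambda>u. \<Sum>s\<in>insert t T. F u s * c s)"
      using insert S by (intro lin_comb_cong) (auto simp: mult.commute)
    finally show ?case .
  qed
qed

text \<open>The left and right hand sides would have traces differing by the dimension.\<close>

lemma no_canonical_commutator:
  assumes char: "\<And>n. n > 0 \<Longrightarrow> of_nat n \<noteq> (0 :: 'k)"
    and "spanning S" and "carrier M \<noteq> {\<zero>}"
    and f: "linear_map f" and g: "linear_map g"
    and comm: "\<And>v. v \<in> carrier M \<Longrightarrow> f (g v) = g (f v) \<oplus> v"
  shows False
proof -
  obtain B where "spanning B"
    and unique: "\<And>c d s. lin_comb B c = lin_comb B d \<Longrightarrow> s \<in> B \<Longrightarrow> c s = d s"
    using basis_exists[OF assms(2)] by blast
  then have B: "B \<subseteq> carrier M" "finite B"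
    and span: "\<And>v. v \<in> carrier M \<Longrightarrow> \<exists>c. v = lin_comb B c"
    by (auto simp: spanning_def)
  have matrix: "\<exists>F. \<forall>t\<in>B. h t = lin_comb B (\<lambda>u. F u t)" if "linear_map h" for h
  proof -
    have "\<forall>t\<in>B. \<exists>c. h t = lin_comb B c"
      using that B span by (auto simp: linear_map_def)
    then obtain c where "\<forall>t\<in>B. h t = lin_comb B (c t)" by metis
    then show ?thesis by (intro exI[of _ "\<lambda>u t. c t u"]) simp
  qed
  from matrix[OF f] obtain F where F: "\<And>t. t \<in> B \<Longrightarrow> f t = lin_comb B (\<lambda>u. F u t)" by blast
  from matrix[OF g] obtain H where H: "\<And>t. t \<in> B \<Longrightarrow> g t = lin_comb B (\<lambda>u. H u t)" by blast
  \<comment> \<open>Comparison of the diagonal entries at \<open>s\<close> in the matrix form of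
    \<open>f g = g f + 1\<close>.\<close>
  have "(\<Sum>t\<in>B. F s t * H t s) = (\<Sum>t\<in>B. H s t * F t s) + 1" if s: "s \<in> B" for s
  proof -
    have "lin_comb B (\<lambda>u. \<Sum>t\<in>B. F u t * H t s) = f (g s)"
      by (simp add: H[OF s] linear_map_lin_comb[OF f B order.refl F])
    also have "\<dots> = g (f s) \<oplus> s" using comm s B by blast
    also have "g (f s) = lin_comb B (\<lambda>u. \<Sum>t\<in>B. H u t * F t s)"
      by (simp add: F[OF s] linear_map_lin_comb[OF g B order.refl H])
    also have "\<dots> \<oplus> s = lin_comb B (\<lambda>u. (\<Sum>t\<in>B. H u t * F t s) + (if u = s then 1 else 0))"
      using s B by (simp add: lin_comb_add lin_comb_unit)
    finally show ?thesis using unique s by fastforce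
  qed
  then have "(\<Sum>s\<in>B. \<Sum>t\<in>B. F s t * H t s) = (\<Sum>s\<in>B. (\<Sum>t\<in>B. H s t * F t s) + 1)"
    by (intro sum.cong) auto
  also have "\<dots> = (\<Sum>s\<in>B. \<Sum>t\<in>B. H s t * F t s) + of_nat (card B)"
    by (simp add: sum.distrib)
  \<comment> \<open>The trace of a product does not depend on the order of the factors.\<close>
  also have "(\<Sum>s\<in>B. \<Sum>t\<in>B. H s t * F t s) = (\<Sum>s\<in>B. \<Sum>t\<in>B. F s t * H t s)"
    by (subst sum.swap) (simp add: mult.commute)
  finally have "of_nat (card B) = (0 :: 'k)" by simp
  then have "B = {}" using char[of "card B"] B by (auto simp: card_gt_0_iff)
  then have "carrier M = {\<zero>}" using span by force
  with assms(3) show False by simp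
qed

end

section \<open>Irreducible representations and normal elements\<close>

locale irreducible_ncpoly_rep = ncpoly_rep M act
  for M :: "('v, 'm) ring_scheme" (structure) and act :: "('g, 'k::field) ncpoly \<Rightarrow> 'v \<Rightarrow> 'v" +
  assumes irreducible: "\<lbrakk>N \<subseteq> carrier M; \<zero> \<in> N; \<And>v w. v \<in> N \<Longrightarrow> w \<in> N \<Longrightarrow> v \<oplus> w \<in> N;
      \<And>p v. v \<in> N \<Longrightarrow> act p v \<in> N\<rbrakk> \<Longrightarrow> N = {\<zero>} \<or> N = carrier M"
    and nontrivial: "carrier M \<noteq> {\<zero>}"
    and fin_dim: "\<exists>S. spanning S"
begin

text \<open>Kernel and image of such a \<open>z\<close> are subrepresentations.\<close>

lemma normal_element:
  assumes l: "\<And>p. \<exists>p'. z * p - p' * z \<in> ann" and r: "\<And>p. \<exists>p'. p * z - z * p' \<in> ann"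
  shows "z \<in> ann \<or> bij_betw (act z) (carrier M) (carrier M)"
proof (cases "z \<in> ann")
  case False
  let ?K = "{v \<in> carrier M. act z v = \<zero>}" and ?I = "act z ` carrier M"
  have "?K = {\<zero>} \<or> ?K = carrier M"
  proof (rule irreducible)
    fix p v assume v: "v \<in> ?K"
    obtain p' where "z * p - p' * z \<in> ann" using l by blast
    with v have "act z (act p v) = act p' (act z v)"
      using act_cong by (metis (no_types, lifting) act_mult mem_Collect_eq)
    then show "act p v \<in> ?K" using v by auto
  qed (auto simp: act_add_right)
  with False have K: "?K = {\<zero>}" by (auto simp: ann_def)
  have "?I = {\<zero>} \<or> ?I = carrier M"
  proof (rule irreducible)
    fix p v assume "v \<in> ?I"
    then obtain u where u: "u \<in> carrier M" "v = act z u" by auto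
    obtain p' where "p * z - z * p' \<in> ann" using r by blast
    with u have "act p v = act z (act p' u)"
      using act_cong by (metis act_mult)
    then show "act p v \<in> ?I" using u by auto
  next
    show "\<zero> \<in> ?I" by (metis act_zero_right imageI zero_closed)
  next
    fix v w assume "v \<in> ?I" "w \<in> ?I"
    then show "v \<oplus> w \<in> ?I" by (auto simp flip: act_add_right)
  qed auto
  with False have I: "?I = carrier M" by (auto simp: ann_def)
  have "inj_on (act z) (carrier M)"
  proof (rule inj_onI)
    fix v w assume vw: "v \<in> carrier M" "w \<in> carrier M" "act z v = act z w"
    have "act z (v \<oplus> \<ominus> w) = \<zero>"
      using vw act_add_right[of v "\<ominus> w" z] act_add_right[of w "\<ominus> w" z] by (simp add: r_neg)
    with K vw have "v \<oplus> \<ominus> w = \<zero>" by blast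
    then show "v = w" using vw minus_equality[of v "\<ominus> w"] by simp
  qed
  with I show ?thesis by (simp add: bij_betw_def)
qed simp

text \<open>Otherwise \<open>a\<close> and \<open>w z\<^sup>-\<^sup>1\<close> would satisfy the Weyl relation.\<close>

lemma normal_element_in_ann:
  assumes char: "\<And>n. n > 0 \<Longrightarrow> of_nat n \<noteq> (0 :: 'k)"
    and "\<And>p. \<exists>p'. z * p - p' * z \<in> ann" and "\<And>p. \<exists>p'. p * z - z * p' \<in> ann"
    and az: "a * z - z * a' \<in> ann" and aw: "a * w - (w * a' + z) \<in> ann"
  shows "z \<in> ann"
proof (rule ccontr)
  assume "z \<notin> ann"
  with normal_element assms have bij: "bij_betw (act z) (carrier M) (carrier M)" by blast
  let ?h = "inv_into (carrier M) (act z)"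
  have h: "?h (act z u) = u" if "u \<in> carrier M" for u
    using bij that by (rule bij_betw_inv_into_left)
  obtain S where S: "spanning S" using fin_dim by blast
  show False
  proof (rule no_canonical_commutator[OF char S nontrivial])
    show "linear_map (act a)" by (rule linear_map_act)
    show "linear_map (\<lambda>v. act w (?h v))"
      by (rule linear_map_comp[OF linear_map_act linear_map_inv[OF linear_map_act bij]])
    fix v assume "v \<in> carrier M"
    \<comment> \<open>Writing \<open>v = z u\<close> removes the inverse: \<open>az\<close> gives
      \<open>a v = z a' u\<close>, so the claim becomes \<open>a w u = w a' u + z u\<close>, which
      is \<open>aw\<close>. Here \<open>a'\<close> is the conjugate of \<open>a\<close> by
      \<open>z\<close>.\<close>
    then obtain u where u: "u \<in> carrier M" "v = act z u"
      using bij by (auto simp: bij_betw_def)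
    have "act a v = act z (act a' u)" using act_cong[OF az u(1)] u by (simp add: act_mult)
    moreover have "act a (act w u) = act w (act a' u) \<oplus> act z u"
      using act_cong[OF aw u(1)] u by (simp add: act_mult act_add_left)
    ultimately show "act a (act w (?h v)) = act w (?h (act a v)) \<oplus> v"
      by (simp add: u h)
  qed
qed

end

section \<open>Modules over quotients of free algebras\<close>

text \<open>Substituting it retracts the free algebra on the whole type onto the free algebra on
  \<open>S\<close>.\<close>

definition restrict_gen :: "'g set \<Rightarrow> 'g \<Rightarrow> ('g, 'k::field) ncpoly" where
  "restrict_gen S g = (if g \<in> S then gen g else 0)"

lemma subst_restrict_gen_closed: "subst (restrict_gen S) p \<in> carrier (free_alg S)"
  by (induction p rule: ncpoly_gen_induct) (auto simp: subst_simps restrict_gen_def intro: free_alg_closed)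

lemma subst_restrict_gen_id:
  assumes "p \<in> carrier (free_alg S)"
  shows "subst (restrict_gen S) p = p"
proof -
  have "map (restrict_gen S) (letters w) = map gen (letters w)" if "w \<in> Poly_Mapping.keys p" for w
    using assms that by (auto simp: carrier_free_alg restrict_gen_def)
  then have "subst (restrict_gen S) p = subst gen p"
    unfolding subst_def
    by (intro sum.cong refl arg_cong2[where f = "(*)"] arg_cong[where f = prod_list])
  also have "subst gen p = p"
    by (induction p rule: ncpoly_gen_induct) (simp_all add: subst_simps)
  finally show ?thesis .
qed

text \<open>Generators outside \<open>S\<close> act as zero, so that the whole type acts.\<close>

definition coset_act ::
    "'g set \<Rightarrow> ('g, 'k::field) ncpoly set \<Rightarrow> (('g, 'k) ncpoly set, 'v) module \<Rightarrow>
      ('g, 'k) ncpoly \<Rightarrow> 'v \<Rightarrow> 'v" where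
  "coset_act S I M p v = (I +>\<^bsub>free_alg S\<^esub> subst (restrict_gen S) p) \<odot>\<^bsub>M\<^esub> v"

context
  fixes S :: "'g set" and I :: "('g, 'k::field) ncpoly set" and M :: "(('g, 'k) ncpoly set, 'v) module"
  assumes I: "ideal I (free_alg S)" and M: "left_module (quot_alg (free_alg S) I) M"
begin

lemma ncpoly_rep_coset_act: "ncpoly_rep M (coset_act S I M)"
proof -
  interpret I: ideal I "free_alg S" by (rule I)
  interpret M: left_module "quot_alg (free_alg S) I" M by (rule M)
  have carrier: "I +>\<^bsub>free_alg S\<^esub> subst (restrict_gen S) p \<in> carrier (quot_alg (free_alg S) I)" for p
    by (simp add: quot_alg_simps I.a_rcosetsI[OF I.a_subset] subst_restrict_gen_closed)
  show ?thesis
  proof (intro ncpoly_rep.intro ncpoly_rep_axioms.intro)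
    show "abelian_group M" by (rule M.M.abelian_group_axioms)
    fix p r v assume v: "v \<in> carrier M"
    show "coset_act S I M p v \<in> carrier M"
      unfolding coset_act_def by (rule M.smult_closed[OF carrier v])
    show "coset_act S I M (p + r) v = coset_act S I M p v \<oplus>\<^bsub>M\<^esub> coset_act S I M r v"
      using M.smult_l_distr[OF carrier carrier v, of p r]
        I.a_rcos_sum[OF subst_restrict_gen_closed subst_restrict_gen_closed, of p r]
      by (simp add: coset_act_def quot_alg_simps subst_add free_alg_ops)
    show "coset_act S I M (p * r) v = coset_act S I M p (coset_act S I M r v)"
      using M.smult_assoc[OF carrier carrier v, of p r]
        I.rcoset_mult_add[OF subst_restrict_gen_closed subst_restrict_gen_closed, of p r]
      by (simp add: coset_act_def quot_alg_simps subst_mult free_alg_ops)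
    show "coset_act S I M 1 v = v"
      using M.smult_one[OF v] by (simp add: coset_act_def quot_alg_simps subst_1 free_alg_ops)
    fix w assume "w \<in> carrier M"
    then show "coset_act S I M p (v \<oplus>\<^bsub>M\<^esub> w) = coset_act S I M p v \<oplus>\<^bsub>M\<^esub> coset_act S I M p w"
      unfolding coset_act_def by (rule M.smult_r_distr[OF carrier v])
  qed
qed

interpretation ncpoly_rep M "coset_act S I M"
  by (rule ncpoly_rep_coset_act)

lemma smult_coset:
  "p \<in> carrier (free_alg S) \<Longrightarrow> (I +>\<^bsub>free_alg S\<^esub> p) \<odot>\<^bsub>M\<^esub> v = coset_act S I M p v"
  by (simp add: coset_act_def subst_restrict_gen_id)

text \<open>Elements of \<open>I\<close> represent the zero coset. This is how defining relations
  become elements of \<open>ann\<close>.\<close>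

lemma ideal_subset_ann: "I \<subseteq> ann"
proof
  interpret I: ideal I "free_alg S" by (rule I)
  fix p assume p: "p \<in> I"
  have "I +>\<^bsub>free_alg S\<^esub> p = I +>\<^bsub>free_alg S\<^esub> 0"
    using I.a_rcos_const[OF p] I.a_rcos_const[OF additive_subgroup.zero_closed[OF ideal.axioms(1)[OF I]]] by (simp add: free_alg_ops)
  then have "coset_act S I M p v = coset_act S I M 0 v" for v
    using I.a_Hcarr[OF p] by (simp add: free_alg_closed flip: smult_coset)
  then show "p \<in> ann" by (simp add: ann_def)
qed

lemma gen_in_ann: "g \<notin> S \<Longrightarrow> gen g \<in> ann"
proof -
  assume "g \<notin> S"
  then have "coset_act S I M (gen g) = coset_act S I M 0"
    by (simp add: coset_act_def subst_simps restrict_gen_def fun_eq_iff)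
  then show ?thesis by (simp add: ann_def)
qed

text \<open>Every coset has a representative in letters from \<open>S\<close>, so the submodules of
  \<open>M\<close> are the subsets stable under \<open>coset_act\<close>, with zero and
  sums.\<close>

lemma irreducible_coset_act:
  assumes "M \<in> fd_simple (quot_alg (free_alg S) I)"
  shows "irreducible_ncpoly_rep M (coset_act S I M)"
proof (intro irreducible_ncpoly_rep.intro irreducible_ncpoly_rep_axioms.intro ncpoly_rep_coset_act)
  from assms have simple: "simple_module (quot_alg (free_alg S) I) M"
    and fd: "finite_dim (quot_alg (free_alg S) I) M" by (auto simp: fd_simple_def)
  then show "carrier M \<noteq> {\<zero>\<^bsub>M\<^esub>}" by (simp add: simple_module_def)
  have "(c \<odot>\<^bsub>quot_alg (free_alg S) I\<^esub> \<one>\<^bsub>quot_alg (free_alg S) I\<^esub>) \<odot>\<^bsub>M\<^esub> s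
      = coset_act S I M (const c) s" for c s
    using quot_alg_smult[OF I free_alg_closed(2)]
    by (simp add: quot_alg_simps(3) free_alg_ops(2) smult_coset free_alg_closed)
  with fd show "\<exists>T. spanning T"
    by (auto simp: finite_dim_def spanning_def lin_comb_def)
  fix N assume N: "N \<subseteq> carrier M" "\<zero>\<^bsub>M\<^esub> \<in> N" "\<And>v w. v \<in> N \<Longrightarrow> w \<in> N \<Longrightarrow> v \<oplus>\<^bsub>M\<^esub> w \<in> N"
    and act: "\<And>p v. v \<in> N \<Longrightarrow> coset_act S I M p v \<in> N"
  have "submodule N (quot_alg (free_alg S) I) M"
  proof (intro submodule.intro submodule_axioms.intro)
    show "subgroup N (add_monoid M)"
    proof (rule subgroup.intro)
      fix v assume "v \<in> N"
      then show "inv\<^bsub>add_monoid M\<^esub> v \<in> N"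
        \<comment> \<open>Closure under negatives comes from the action of the scalar
          \<open>- 1\<close>.\<close>
        using act[of v "- 1"] N(1) by (auto simp: act_uminus_left simp flip: a_inv_def)
    qed (use N in auto)
    fix a v assume "a \<in> carrier (quot_alg (free_alg S) I)" "v \<in> N"
    then show "a \<odot>\<^bsub>M\<^esub> v \<in> N"
      using act by (auto simp: quot_alg_simps A_RCOSETS_def' smult_coset)
  qed
  with simple show "N = {\<zero>\<^bsub>M\<^esub>} \<or> N = carrier M" by (simp add: simple_module_def)
qed

end

section \<open>Representations of the Laistrygonian algebra\<close>

lemma const_left_commute: "p * (const c * r) = const c * (p * (r :: ('g, 'k::field) ncpoly))"
  by (metis const_comm mult.assoc)

text \<open>Stated for generators so that, as rewrite rules, they move scalars to the left without
  permuting scalars among themselves.\<close>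

lemma gen_const_commute:
  "gen g * const c = const c * (gen g :: ('g, 'k::field) ncpoly)"
  "gen g * (const c * r) = const c * (gen g * (r :: ('g, 'k::field) ncpoly))"
  by (rule const_comm[symmetric], rule const_left_commute)

lemma const_mult_merge:
  "const a * const b = const (a * b)"
  "const a * (const b * r) = const (a * b) * (r :: ('g, 'k::field) ncpoly)"
  by (simp_all add: const_mult mult.assoc)

lemma const_diff: "const (a - b) = const a - const b"
  by (metis add_diff_cancel const_add diff_add_cancel)

lemma const_0: "const 0 = 0" and const_1: "const 1 = 1"
  by (simp_all add: const_def)

lemma const_uminus: "const (- a) = - const a"
  by (metis const_0 const_diff diff_0)

lemmas nc_simps = algebra_simps gen_const_commute const_mult_merge

section \<open>Normality modulo the annihilator\<close>

context ncpoly_rep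
begin

lemma left_normal_add:
  "\<exists>p'. z * p - p' * z \<in> ann \<Longrightarrow> \<exists>r'. z * r - r' * z \<in> ann \<Longrightarrow> \<exists>s. z * (p + r) - s * z \<in> ann"
proof (elim exE)
  fix p' r' assume "z * p - p' * z \<in> ann" "z * r - r' * z \<in> ann"
  then have "(z * p - p' * z) + (z * r - r' * z) \<in> ann" by (rule ann_add)
  then show ?thesis by (intro exI[of _ "p' + r'"]) (simp add: algebra_simps)
qed

lemma left_normal_mult:
  "\<exists>p'. z * p - p' * z \<in> ann \<Longrightarrow> \<exists>r'. z * r - r' * z \<in> ann \<Longrightarrow> \<exists>s. z * (p * r) - s * z \<in> ann"
proof (elim exE)
  fix p' r' assume "z * p - p' * z \<in> ann" "z * r - r' * z \<in> ann"
  then have "(z * p - p' * z) * r + p' * (z * r - r' * z) \<in> ann"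
    by (intro ann_add ann_mult_left ann_mult_right)
  then show ?thesis by (intro exI[of _ "p' * r'"]) (simp add: algebra_simps)
qed

lemma right_normal_add:
  "\<exists>p'. p * z - z * p' \<in> ann \<Longrightarrow> \<exists>r'. r * z - z * r' \<in> ann \<Longrightarrow> \<exists>s. (p + r) * z - z * s \<in> ann"
proof (elim exE)
  fix p' r' assume "p * z - z * p' \<in> ann" "r * z - z * r' \<in> ann"
  then have "(p * z - z * p') + (r * z - z * r') \<in> ann" by (rule ann_add)
  then show ?thesis by (intro exI[of _ "p' + r'"]) (simp add: algebra_simps)
qed

lemma right_normal_mult:
  "\<exists>p'. p * z - z * p' \<in> ann \<Longrightarrow> \<exists>r'. r * z - z * r' \<in> ann \<Longrightarrow> \<exists>s. p * r * z - z * s \<in> ann"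
proof (elim exE)
  fix p' r' assume "p * z - z * p' \<in> ann" "r * z - z * r' \<in> ann"
  then have "p * (r * z - z * r') + (p * z - z * p') * r' \<in> ann"
    by (intro ann_add ann_mult_left ann_mult_right)
  then show ?thesis by (intro exI[of _ "p' * r'"]) (simp add: algebra_simps)
qed

text \<open>The \<open>p\<close> that can be moved past \<open>z\<close>, at the price of being
  changed, form a subalgebra containing the scalars; so generators suffice.\<close>

lemma left_normalI:
  assumes "\<And>g. \<exists>p'. z * gen g - p' * z \<in> ann"
  shows "\<exists>p'. z * p - p' * z \<in> ann"
proof (induction p rule: ncpoly_gen_induct)
  case (const c)
  then show ?case by (intro exI[of _ "const c"]) (simp add: const_comm[of c z] ann_zero)
qed (auto intro: assms left_normal_add left_normal_mult)

lemma right_normalI: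
  assumes "\<And>g. \<exists>p'. gen g * z - z * p' \<in> ann"
  shows "\<exists>p'. p * z - z * p' \<in> ann"
proof (induction p rule: ncpoly_gen_induct)
  case (const c)
  then show ?case by (intro exI[of _ "const c"]) (simp add: const_comm[of c z] ann_zero)
qed (auto intro: assms right_normal_add right_normal_mult)

end

text \<open>Setting \<open>z_n = 0\<close> for \<open>n > G\<close> lets the relations for
  \<open>z_n\<close> hold uniformly in \<open>n\<close>; the one between \<open>x_2\<close> and
  \<open>z_G\<close> is the case \<open>n = G\<close> of \<open>rel_x2z\<close>.\<close>

locale laistrygonian_rep = irreducible_ncpoly_rep M act
  for M :: "('v, 'm) ring_scheme" (structure)
    and act :: "(lgen, 'k::field_char_0) ncpoly \<Rightarrow> 'v \<Rightarrow> 'v" +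
  fixes q :: 'k and G :: nat
  assumes q: "q \<noteq> 0"
    and rel_x2x1: "gen X2 * gen X1 - gen X1 * gen X2 + const (1 / 2) * gen X1 ^ 2 \<in> ann"
    and rel_x1z0: "gen X1 * gen (Z 0) - const q * gen (Z 0) * gen X1 \<in> ann"
    and rel_x2z: "gen X2 * gen (Z n) - const q * gen (Z n) * gen X2 - gen (Z (Suc n)) \<in> ann"
    and rel_zz: "gen (Z n) * gen (Z (Suc n)) - const (inverse q) * gen (Z (Suc n)) * gen (Z n) \<in> ann"
    and Z_large: "n > G \<Longrightarrow> gen (Z n) \<in> ann"
begin

text \<open>Since \<open>z_(n+1) = x_2 z_n - q z_n x_2\<close> on \<open>M\<close>, what can be done
  for \<open>x_2\<close> and \<open>z_0\<close> propagates to every \<open>z_n\<close>.\<close>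

lemma left_normal_Z:
  assumes x2: "\<exists>p'. z * gen X2 - p' * z \<in> ann" and z0: "\<exists>p'. z * gen (Z 0) - p' * z \<in> ann"
  shows "\<exists>p'. z * gen (Z n) - p' * z \<in> ann"
proof (induction n)
  case (Suc n)
  have c: "\<exists>p'. z * const c - p' * z \<in> ann" for c
    by (rule exI[of _ "const c"]) (simp add: const_comm[of c z] ann_zero)
  have "\<exists>p'. z * (gen X2 * gen (Z n) + const (- q) * (gen (Z n) * gen X2)) - p' * z \<in> ann"
    by (intro left_normal_add left_normal_mult Suc x2 c)
  then obtain p' where
    "z * (gen X2 * gen (Z n) + const (- q) * (gen (Z n) * gen X2)) - p' * z \<in> ann" by blast
  from ann_diff[OF this ann_mult_left[OF rel_x2z[of n], of z]]
  show ?case by (intro exI[of _ p']) (simp add: nc_simps const_uminus const_left_commute[of z])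
qed (rule z0)

lemma right_normal_Z:
  assumes x2: "\<exists>p'. gen X2 * z - z * p' \<in> ann" and z0: "\<exists>p'. gen (Z 0) * z - z * p' \<in> ann"
  shows "\<exists>p'. gen (Z n) * z - z * p' \<in> ann"
proof (induction n)
  case (Suc n)
  have c: "\<exists>p'. const c * z - z * p' \<in> ann" for c
    by (rule exI[of _ "const c"]) (simp add: const_comm[of c z] ann_zero)
  have "\<exists>p'. (gen X2 * gen (Z n) + const (- q) * (gen (Z n) * gen X2)) * z - z * p' \<in> ann"
    by (intro right_normal_add right_normal_mult Suc x2 c)
  then obtain p' where
    "(gen X2 * gen (Z n) + const (- q) * (gen (Z n) * gen X2)) * z - z * p' \<in> ann" by blast
  from ann_diff[OF this ann_mult_right[OF rel_x2z[of n], of z]]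
  show ?case by (intro exI[of _ p']) (simp add: nc_simps const_uminus const_left_commute[of z])
qed (rule z0)

text \<open>The first relation reads \<open>x_1 x_2 = (x_2 + x_1/2) x_1\<close> and also
  \<open>x_2 x_1 = x_1 (x_2 - x_1/2)\<close>. Together with \<open>x_1 z_0 = q z_0 x_1\<close> it
  makes \<open>x_1\<close> normal.\<close>

lemma X1_ann: "gen X1 \<in> ann"
proof (rule normal_element_in_ann)
  have "gen X1 * gen X2 - (gen X2 + const (1 / 2) * gen X1) * gen X1 \<in> ann"
    using ann_uminus[OF rel_x2x1] by (simp add: nc_simps power2_eq_square)
  then have x2: "\<exists>p'. gen X1 * gen X2 - p' * gen X1 \<in> ann" by blast
  have z0: "\<exists>p'. gen X1 * gen (Z 0) - p' * gen X1 \<in> ann"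
    using rel_x1z0 by blast
  show "\<exists>p'. gen X1 * p - p' * gen X1 \<in> ann" for p
  proof (rule left_normalI)
    fix g show "\<exists>p'. gen X1 * gen g - p' * gen X1 \<in> ann"
      using x2 z0 left_normal_Z[OF x2 z0] ann_zero by (cases g) (auto intro: exI[of _ "gen X1"])
  qed
  show az: "gen X2 * gen X1 - gen X1 * (gen X2 - const (1 / 2) * gen X1) \<in> ann"
    using rel_x2x1 by (simp add: nc_simps power2_eq_square)
  then have x2: "\<exists>p'. gen X2 * gen X1 - gen X1 * p' \<in> ann" by blast
  have "gen (Z 0) * gen X1 - gen X1 * (const (inverse q) * gen (Z 0)) \<in> ann"
    using ann_mult_left[OF rel_x1z0, of "- const (inverse q)"] q by (simp add: nc_simps const_1)
  then have z0: "\<exists>p'. gen (Z 0) * gen X1 - gen X1 * p' \<in> ann" by blast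
  show "\<exists>p'. p * gen X1 - gen X1 * p' \<in> ann" for p
  proof (rule right_normalI)
    fix g show "\<exists>p'. gen g * gen X1 - gen X1 * p' \<in> ann"
      using x2 z0 right_normal_Z[OF x2 z0] ann_zero by (cases g) (auto intro: exI[of _ "gen X1"])
  qed
  \<comment> \<open>With \<open>w = 2\<close> and \<open>a' = x_2 - x_1/2\<close> the Weyl condition
    is the identity \<open>2 x_2 = 2 (x_2 - x_1/2) + x_1\<close>.\<close>
  show "gen X2 * const 2 - (const 2 * (gen X2 - const (1 / 2) * gen X1) + gen X1) \<in> ann"
    using ann_zero by (simp add: nc_simps const_1)
qed simp

text \<open>The skew derivation \<open>p \<mapsto> x\<^sub>2 p - \<sigma>(p) x\<^sub>2\<close> with \<open>\<sigma>(z\<^sub>n) = q z\<^sub>n\<close> sends the relation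
  for \<open>(i, j)\<close> to a combination of those for \<open>(i, j + 1)\<close> and \<open>(i + 1, j)\<close>.\<close>

lemma ZZ_step:
  assumes "gen (Z j) * gen (Z i) - const c * gen (Z i) * gen (Z j) \<in> ann"
    and "gen (Z j) * gen (Z (Suc i)) - const (c / q) * gen (Z (Suc i)) * gen (Z j) \<in> ann"
  shows "gen (Z (Suc j)) * gen (Z i) - const (q * c) * gen (Z i) * gen (Z (Suc j)) \<in> ann"
proof -
  let ?R = "gen (Z j) * gen (Z i) - const c * gen (Z i) * gen (Z j)"
  let ?R' = "gen (Z j) * gen (Z (Suc i)) - const (c / q) * gen (Z (Suc i)) * gen (Z j)"
  let ?D = "\<lambda>n. gen X2 * gen (Z n) - const q * gen (Z n) * gen X2 - gen (Z (Suc n))"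
  have "gen X2 * ?R \<in> ann" "const (q * q) * (?R * gen X2) \<in> ann" "const q * ?R' \<in> ann"
    using assms by (auto intro: ann_mult_left ann_mult_right)
  moreover have "?D j * gen (Z i) \<in> ann" "const c * (?D i * gen (Z j)) \<in> ann"
    "const q * gen (Z j) * ?D i \<in> ann" "const (q * c) * gen (Z i) * ?D j \<in> ann"
    using rel_x2z[of i] rel_x2z[of j] by (auto intro: ann_mult_left ann_mult_right)
  \<comment> \<open>Moving \<open>x_2\<close> to the right through \<open>?R\<close> with
    \<open>?D\<close> leaves the claimed relation plus \<open>q\<close> times \<open>?R'\<close>.
    The factor \<open>q * q\<close> arises because \<open>?R\<close> is quadratic in the
    \<open>z_n\<close>.\<close>
  ultimately have "gen X2 * ?R - const (q * q) * (?R * gen X2)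
      - ?D j * gen (Z i) - const q * gen (Z j) * ?D i
      + const c * (?D i * gen (Z j)) + const (q * c) * gen (Z i) * ?D j - const q * ?R' \<in> ann"
    by (intro ann_add ann_diff)
  then show ?thesis using q by (simp add: nc_simps)
qed

text \<open>Induction on the distance \<open>d\<close> of the indices: \<open>ZZ_step\<close>
  reaches \<open>e + 2\<close> from \<open>e + 1\<close> at \<open>i\<close> and \<open>e\<close> at
  \<open>i + 1\<close>. Two base cases are therefore given, \<open>d = 1\<close> being the defining
  relation solved for the other product.\<close>

lemma ZZ_commute:
  "gen (Z (i + d)) * gen (Z i) - const (q ^ d) * gen (Z i) * gen (Z (i + d)) \<in> ann"
proof (induction d arbitrary: i rule: less_induct)
  case (less d)
  consider "d = 0" | "d = 1" | e where "d = Suc (Suc e)" by (metis One_nat_def not0_implies_Suc)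
  then show ?case
  proof cases
    case 1
    then show ?thesis using ann_zero by (simp add: const_1)
  next
    case 2
    then show ?thesis
      using ann_mult_left[OF rel_zz[of i], of "- const q"] q by (simp add: nc_simps const_1)
  next
    case 3
    have "gen (Z (i + Suc e)) * gen (Z (Suc i))
        - const (q ^ Suc e / q) * gen (Z (Suc i)) * gen (Z (i + Suc e)) \<in> ann"
      using less.IH[of e "Suc i"] q 3 by simp
    from ZZ_step[OF less.IH[of "Suc e" i] this] 3 show ?thesis by simp
  qed
qed

text \<open>With \<open>z_(m+1)\<close> acting as zero, \<open>z_m\<close> commutes up to powers of
  \<open>q\<close> with \<open>x_2\<close> and all lower \<open>z_i\<close>, while
  \<open>x_1\<close> and the higher \<open>z_i\<close> vanish; hence it is normal.\<close>

lemma Z_ann_step: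
  assumes "m > 0" and above: "\<And>n. n > m \<Longrightarrow> gen (Z n) \<in> ann"
  shows "gen (Z m) \<in> ann"
proof (rule normal_element_in_ann)
  have x2: "gen X2 * gen (Z m) - const q * gen (Z m) * gen X2 \<in> ann"
    using ann_add[OF rel_x2z[of m] above[of "Suc m"]] by simp
  have zz: "gen (Z m) * gen (Z i) - const (q ^ (m - i)) * gen (Z i) * gen (Z m) \<in> ann" if "i \<le> m" for i
    using ZZ_commute[of i "m - i"] that by simp
  show "\<exists>p'. gen (Z m) * p - p' * gen (Z m) \<in> ann" for p
  proof (rule left_normalI)
    fix g show "\<exists>p'. gen (Z m) * gen g - p' * gen (Z m) \<in> ann"
    proof (cases g)
      case X1
      then show ?thesis using X1_ann by (intro exI[of _ 0]) (simp add: ann_closed)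
    next
      case X2
      then show ?thesis using ann_mult_left[OF x2, of "- const (inverse q)"] q
        by (intro exI[of _ "const (inverse q) * gen X2"]) (simp add: nc_simps const_1)
    next
      case (Z i)
      show ?thesis
      proof (cases "i \<le> m")
        case True
        with zz Z show ?thesis by blast
      next
        case False
        then show ?thesis using above Z by (intro exI[of _ 0]) (simp add: ann_closed)
      qed
    qed
  qed
  show "\<exists>p'. p * gen (Z m) - gen (Z m) * p' \<in> ann" for p
  proof (rule right_normalI)
    fix g show "\<exists>p'. gen g * gen (Z m) - gen (Z m) * p' \<in> ann"
    proof (cases g)
      case X1
      then show ?thesis using X1_ann by (intro exI[of _ 0]) (simp add: ann_closed)
    next
      case X2
      then show ?thesis using x2
        by (intro exI[of _ "const q * gen X2"]) (simp add: nc_simps)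
    next
      case (Z i)
      show ?thesis
      proof (cases "i \<le> m")
        case True
        from ann_mult_left[OF zz[OF this], of "- const (inverse (q ^ (m - i)))"] Z q show ?thesis
          by (intro exI[of _ "const (inverse (q ^ (m - i))) * gen (Z i)"]) (simp add: nc_simps const_1)
      next
        case False
        then show ?thesis using above Z by (intro exI[of _ 0]) (simp add: ann_closed)
      qed
    qed
  qed
  show "gen X2 * gen (Z m) - gen (Z m) * (const q * gen X2) \<in> ann"
    using x2 by (simp add: nc_simps)
  \<comment> \<open>The Weyl partner is \<open>w = z_(m-1)\<close>, which exists because
    \<open>m > 0\<close>; the condition is the relation producing \<open>z_m\<close> from
    it.\<close>
  show "gen X2 * gen (Z (m - 1)) - (gen (Z (m - 1)) * (const q * gen X2) + gen (Z m)) \<in> ann"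
    using rel_x2z[of "m - 1"] \<open>m > 0\<close> by (simp add: nc_simps)
qed simp

text \<open>Descending induction on \<open>m\<close>, starting from the indices above
  \<open>G\<close>, where \<open>z_m\<close> is zero by convention.\<close>

lemma Z_ann: "m > 0 \<Longrightarrow> gen (Z m) \<in> ann"
proof (induction "G - m" arbitrary: m rule: less_induct)
  case less
  show ?case
  proof (cases "m > G")
    case False
    show ?thesis
    proof (rule Z_ann_step[OF less.prems])
      fix n assume "n > m"
      then show "gen (Z n) \<in> ann"
        using less.hyps[of n] Z_large[of n] by (cases "n > G") auto
    qed
  qed (rule Z_large)
qed

end

section \<open>The kernel of the projection to the quantum plane\<close>

lemma (in ncpoly_rep) ideal_ann: "ideal ann (free_alg UNIV)"
proof (rule idealI)
  have carrier: "p \<in> carrier (free_alg UNIV)" for p :: "('g, 'k) ncpoly"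
    by (simp add: carrier_free_alg)
  show R: "ring (free_alg UNIV :: ('k, ('g, 'k) ncpoly) module)" by (rule ring_free_alg)
  interpret R: ring "free_alg UNIV :: ('k, ('g, 'k) ncpoly) module" by (rule R)
  show "subgroup ann (add_monoid (free_alg UNIV))"
  proof (rule R.add.subgroupI)
    show "\<ominus>\<^bsub>free_alg UNIV\<^esub> p \<in> ann" if "p \<in> ann" for p
    proof -
      have "\<ominus>\<^bsub>free_alg UNIV\<^esub> p = - p"
        by (rule R.minus_equality) (simp_all add: carrier free_alg_ops)
      then show ?thesis using that by (simp add: ann_uminus)
    qed
  qed (use ann_zero in \<open>auto simp: carrier free_alg_ops intro: ann_add\<close>)
qed (auto simp: free_alg_ops intro: ann_mult_left ann_mult_right)

text \<open>A right inverse of \<open>nu_gen\<close> between the free algebras. It respects the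
  relation of the quantum plane only after \<open>z_1\<close> is set to zero, as happens on
  \<open>M\<close>.\<close>

definition nu_section :: "pgen \<Rightarrow> (lgen, 'k::field) ncpoly" where
  "nu_section = case_pgen (gen X2) (gen (Z 0))"

context laistrygonian_rep
begin

text \<open>The lift \<open>x_2 z_0 - q z_0 x_2\<close> of the defining relation equals
  \<open>z_1\<close> on \<open>M\<close>, hence acts as zero.\<close>

lemma subst_nu_section_pideal:
  assumes "r \<in> pideal q"
  shows "subst nu_section r \<in> ann"
proof -
  let ?K = "{p \<in> carrier (free_alg UNIV). subst nu_section p \<in> ann}"
  have "ring_hom_ring (free_alg UNIV) (free_alg UNIV) (subst (nu_section :: _ \<Rightarrow> (_, 'k) ncpoly))"
    by (intro ring_hom_ringI2 ring_free_alg ring_hom_memI)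
       (auto simp: free_alg_ops subst_simps carrier_free_alg)
  then have K: "ideal ?K (free_alg UNIV)"
    by (rule ring_hom_ring.ideal_vimage[OF _ ideal_ann])
  have "gen X2 * gen (Z 0) - const q * gen (Z 0) * gen X2 \<in> ann"
    using ann_add[OF rel_x2z[of 0] Z_ann[of "Suc 0"]] by simp
  then have "prels q \<subseteq> ?K"
    by (auto simp: prels_def nu_section_def carrier_free_alg subst_simps)
  then have "pideal q \<subseteq> ?K"
    unfolding pideal_def by (intro ring.genideal_minimal ring_free_alg K)
  with assms show ?thesis by blast
qed

text \<open>The composite fixes \<open>x_2\<close> and \<open>z_0\<close> and sends the other
  generators to zero, as they act on \<open>M\<close>.\<close>

lemma diff_nu_section_ann: "p - subst nu_section (subst nu_gen p) \<in> ann"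
proof (induction p rule: ncpoly_gen_induct)
  case (gen g)
  show ?case
    using X1_ann Z_ann ann_zero by (cases g) (auto simp: subst_simps nu_section_def)
next
  case (add p r)
  from ann_add[OF this] show ?case by (simp add: subst_simps algebra_simps)
next
  case (mult p r)
  let ?s = "\<lambda>p. subst nu_section (subst nu_gen p)"
  \<comment> \<open>Telescoping of \<open>p r - ?s p * ?s r\<close>.\<close>
  have "(p - ?s p) * r + ?s p * (r - ?s r) \<in> ann"
    using mult by (intro ann_add ann_mult_left ann_mult_right)
  then show ?case by (simp add: subst_simps algebra_simps)
qed (simp add: subst_simps ann_zero)

end

lemma laistrygonian_rep_coset_act:
  fixes q :: "'k::field_char_0"
  assumes "q \<noteq> 0" and M: "M \<in> fd_simple (laistrygonian q G)"
  shows "laistrygonian_rep M (coset_act (lgens G) (lideal q G) M) q G"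
proof -
  have lm: "left_module (quot_alg (free_alg (lgens G)) (lideal q G)) M"
    using M by (simp add: fd_simple_def simple_module_def laistrygonian_eq)
  interpret irreducible_ncpoly_rep M "coset_act (lgens G) (lideal q G) M"
    using M unfolding laistrygonian_eq by (rule irreducible_coset_act[OF ideal_lideal lm])
  have "lrels q G \<subseteq> lideal q G"
    unfolding lideal_def by (intro ring.genideal_self ring_free_alg lrels_carrier)
  also have "\<dots> \<subseteq> ann" by (rule ideal_subset_ann[OF ideal_lideal lm])
  finally have rels: "lrels q G \<subseteq> ann" .
  have large: "gen (Z n) \<in> ann" if "n > G" for n
    by (rule gen_in_ann[OF ideal_lideal lm]) (use that in \<open>auto simp: lgens_def\<close>)
  show ?thesis
  proof
    show "gen X2 * gen X1 - gen X1 * gen X2 + const (1 / 2) * gen X1 ^ 2 \<in> ann"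
      "gen X1 * gen (Z 0) - const q * gen (Z 0) * gen X1 \<in> ann"
      using rels by (auto simp: lrels_def Let_def)
    fix n
    consider "n < G" | "n = G" | "n > G" by linarith
    then show "gen X2 * gen (Z n) - const q * gen (Z n) * gen X2 - gen (Z (Suc n)) \<in> ann"
    proof cases
      case 1
      then show ?thesis using rels by (auto simp: lrels_def Let_def)
    next
      case 2
      have "gen X2 * gen (Z G) - const q * gen (Z G) * gen X2 \<in> ann"
        using rels by (auto simp: lrels_def Let_def)
      from ann_diff[OF this large[of "Suc G"]] 2 show ?thesis by simp
    next
      case 3
      then show ?thesis
        using large[of n] large[of "Suc n"]
        by (simp add: ann_diff ann_mult_left ann_mult_right)
    qed
    show "gen (Z n) * gen (Z (Suc n)) - const (inverse q) * gen (Z (Suc n)) * gen (Z n) \<in> ann"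
    proof (cases "n < G")
      case True
      then show ?thesis using rels by (auto simp: lrels_def Let_def)
    next
      case False
      then have "gen (Z (Suc n)) \<in> ann" by (intro large) simp
      then show ?thesis by (intro ann_diff ann_mult_left ann_mult_right)
    qed
  qed (use assms large in auto)
qed

text \<open>A representative \<open>p\<close> acts as its image under \<open>nu_gen\<close> lifted
  back by \<open>nu_section\<close>; if \<open>C\<close> is in the kernel, that image lies in
  \<open>pideal q\<close>, so its lift acts as zero.\<close>

lemma ker_nu_kills_fd_simple:
  fixes q :: "'k::field_char_0"
  assumes "q \<noteq> 0" "G \<ge> 1" and M: "M \<in> fd_simple (laistrygonian q G)"
    and C: "C \<in> carrier (laistrygonian q G)" "nu q C = \<zero>\<^bsub>quantum_plane q\<^esub>" and v: "v \<in> carrier M"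
  shows "C \<odot>\<^bsub>M\<^esub> v = \<zero>\<^bsub>M\<^esub>"
proof -
  interpret laistrygonian_rep M "coset_act (lgens G) (lideal q G) M" q G
    using assms(1) M by (rule laistrygonian_rep_coset_act)
  interpret J: ideal "pideal q" "free_alg UNIV" by (rule ideal_pideal)
  have lm: "left_module (quot_alg (free_alg (lgens G)) (lideal q G)) M"
    using M by (simp add: fd_simple_def simple_module_def laistrygonian_eq)
  obtain p where p: "p \<in> carrier (free_alg (lgens G))" and C_p: "C = lideal q G +>\<^bsub>free_alg (lgens G)\<^esub> p"
    using C(1) by (rule laistrygonian_carrierE)
  have "subst nu_gen p \<in> pideal q +>\<^bsub>free_alg UNIV\<^esub> subst nu_gen p"
    by (rule J.a_rcos_self) (simp add: carrier_free_alg)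
  also have "\<dots> = pideal q"
    using C(2) by (simp add: C_p nu_coset[OF assms(2) p] quantum_plane_eq quot_alg_simps)
  finally have "subst nu_section (subst nu_gen p) \<in> ann" by (rule subst_nu_section_pideal)
  from ann_add[OF diff_nu_section_ann[of p] this] have "p \<in> ann" by simp
  then show ?thesis
    unfolding C_p using v by (simp add: smult_coset[OF ideal_lideal lm p] ann_def)
qed

lemma surjective_algebra_map_nu:
  fixes q :: "'k::field"
  assumes "G \<ge> 1"
  shows "surjective_algebra_map (laistrygonian q G) (quantum_plane q) (nu q)"
proof (rule surjective_algebra_map.intro)
  show closed: "c \<odot>\<^bsub>laistrygonian q G\<^esub> \<one>\<^bsub>laistrygonian q G\<^esub> \<in> carrier (laistrygonian q G)" for c
  proof -
    interpret I: ideal "lideal q G" "free_alg (lgens G)" by (rule ideal_lideal)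
    have "c \<odot>\<^bsub>laistrygonian q G\<^esub> \<one>\<^bsub>laistrygonian q G\<^esub> = lideal q G +>\<^bsub>free_alg (lgens G)\<^esub> (const c * 1)"
      unfolding laistrygonian_eq quot_alg_simps(3) free_alg_ops(2)
      by (rule quot_alg_smult[OF ideal_lideal free_alg_closed(2)])
    then show ?thesis
      by (simp add: laistrygonian_eq quot_alg_simps I.a_rcosetsI[OF I.a_subset] free_alg_closed)
  qed
  show "nu q (c \<odot>\<^bsub>laistrygonian q G\<^esub> \<one>\<^bsub>laistrygonian q G\<^esub>) = c \<odot>\<^bsub>quantum_plane q\<^esub> \<one>\<^bsub>quantum_plane q\<^esub>" for c
    using nu_smult[OF assms ring.ring_simprules(6)[OF ring_laistrygonian]]
      ring_hom_one[OF nu_ring_hom[OF assms]] by metis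
qed (fact ring_laistrygonian ring_quantum_plane nu_ring_hom[OF assms] nu_surj[OF assms])+

theorem theorem3p5:
  fixes q :: "'k::{alg_closed_field, field_char_0}" and G :: nat
  assumes "q \<noteq> 0" and "G \<ge> 1"
  shows
    "pullback_class (laistrygonian q G) (nu q) respects
       (iso_rel (quantum_plane q) ::
         (((pgen, 'k) ncpoly set, 'v) module \<times> ((pgen, 'k) ncpoly set, 'v) module) set) \<and>
     bij_betw (\<lambda>C. \<Union>N\<in>C. pullback_class (laistrygonian q G) (nu q) N)
       (irrep (quantum_plane q) :: ((pgen, 'k) ncpoly set, 'v) module set set)
       (irrep (laistrygonian q G)) \<and>
     (\<forall>M \<in> (fd_simple (laistrygonian q G) :: ((lgen, 'k) ncpoly set, 'v) module set).
       factors_through (laistrygonian q G) (quantum_plane q) (nu q) M)"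
proof -
  interpret surjective_algebra_map "laistrygonian q G" "quantum_plane q" "nu q"
    by (rule surjective_algebra_map_nu[OF assms(2)])
  have factor: "factors_through (laistrygonian q G) (quantum_plane q) (nu q) M"
    if "M \<in> fd_simple (laistrygonian q G)" for M :: "((lgen, 'k) ncpoly set, 'v) module"
    using that ker_nu_kills_fd_simple[OF assms that]
    by (intro factors_throughI) (simp_all add: fd_simple_def simple_module_def)
  show ?thesis
    by (intro conjI pullback_class_respects bij_betw_pullback_class ballI factor)
qed

end
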